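(* Let $I=[a,b]$ be a compact interval and let $F\in\mathcal{PM}(I,I)$ have forts $c_1<\dots<c_v$, with $c_0:=a$ and $c_{v+1}:=b$. Suppose $H(F)=1$, that $K(F)=[c_k,c_{k+1}]$ for some $1\le k\le v-1$, that $F$ is strictly increasing on $[c_k,c_{k+1}]$, and that $F$ does not satisfy the characteristic endpoints condition. Suppose that at least one of the following three conditions holds: (1) $c_k<F(c_{k+2})<F(c_k)$ and $F(c_{k-1})=c_{k+1}=F(c_{k+1})$; (2) $c_k=F(c_k)=F(c_{k+2})$ and $F(c_{k+1})<F(c_{k-1})<c_{k+1}$; (3) $c_k<F(c_{k+2})<F(c_k)$ and $F(c_{k+1})<F(c_{k-1})<c_{k+1}$. Suppose further that both (L) and (R) hold: (L) There are an integer $s\ge 0$ and points $c_{\ell_0}:=c_{k-1}>c_{\ell_1}>\dots>c_{\ell_s}>c_{\ell_{s+1}}:=c_0$ from $\{c_0,\dots,c_{v}\}$ such that: for $0\le j\le s$, $F(c_{\ell_j})=F(c_{k-1})$ if $j\equiv 0$ or $1\pmod 4$, and $F(c_{\ell_j})=F(c_{k+2})$ if $j\equiv 2$ or $3\pmod 4$; for $0\le j\le s$ with $j\equiv 0,1$ or $3\pmod 4$, $\max_{x\in[c_{\ell_{j+1}},c_{\ell_j}]}F(x)=F(c_{k-1})$; for $0\le j\le s$ with $j\equiv 1,2$ or $3\pmod 4$, $\min_{x\in[c_{\ell_{j+1}},c_{\ell_j}]}F(x)=F(c_{k+2})$. (R) There are an integer $t\ge 0$ and points $c_{r_0}:=c_{k+2}<c_{r_1}<\dots<c_{r_t}<c_{r_{t+1}}:=c_{v+1}$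 from $\{c_1,\dots,c_{v+1}\}$ such that: for $0\le j\le t$, $F(c_{r_j})=F(c_{k+2})$ if $j\equiv 0$ or $1\pmod 4$, and $F(c_{r_j})=F(c_{k-1})$ if $j\equiv 2$ or $3\pmod 4$; for $0\le j\le t$ with $j\equiv 0,1$ or $3\pmod 4$, $\min_{x\in[c_{r_j},c_{r_{j+1}}]}F(x)=F(c_{k+2})$; for $0\le j\le t$ with $j\equiv 1,2$ or $3\pmod 4$, $\max_{x\in[c_{r_j},c_{r_{j+1}}]}F(x)=F(c_{k-1})$. Then there exists a continuous function $f:I\to I$ with $f\circ f=F$ on $I$ and $H(f)=2$ such that $f$ is strictly increasing on $[c_k,c_{k+1}]$.
   Context: Let $I=[a,b]$ be a compact interval. A continuous map $F:I\to I$ is a piecewise monotone (PM) function if it has only finitely many forts (non-monotone points), where a fort is a point of $(a,b)$ in no neighbourhood of which $F$ is strictly monotone. If the forts are $c_1<\dots<c_v$, put $c_0:=a$, $c_{v+1}:=b$; then $F$ is strictly monotone on each $[c_i,c_{i+1}]$, $0\le i\le v$, and these subintervals are called the laps of $F$. $\mathcal{PM}(I,I)$ is the set of all PM functions $I\to I$, and $N(F)$ is the number of forts of $F$ (so $N(F)=v$, and $N(F^0)=0$, where $F^0$ is the identity and $F^i$ is the $i$-th iterate). The sequence $N(F^0)\le N(F)\le N(F^2)\le\cdots$ is nondecreasing; the height $H(F)$ is the smallest integer $i\ge 0$ with $N(F^i)=N(F^{i+1})$, and $H(F)=\infty$ if there is none. When $H(F)=1$, there is a lap of $F$ containing the range $F(I)$;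 this lap is called the characteristic interval $K(F)$. (Conversely, existence of a lap covering the range characterizes $H(F)=1$ for maps having forts.) Characteristic endpoints condition for $F$ with $K(F)=[a',b']$: $F$ on $I$ cannot reach $a'$, respectively $b'$, unless $F(a')=a'$, respectively $F(b')=b'$; i.e. ($a'\in F(I)\Rightarrow F(a')=a'$) and ($b'\in F(I)\Rightarrow F(b')=b'$). *)

theory Defs
  imports Complex_Main "HOL-Library.Extended_Nat"
begin

text \<open>
  A self-map of the interval $I = [a,b]$ is a function on all reals of which only the values on
  \<open>{a..b}\<close> are used; every notion below depends only on that restriction.
\<close>

definition strictly_monotone_on :: "real set \<Rightarrow> (real \<Rightarrow> real) \<Rightarrow> bool" where
  "strictly_monotone_on S F \<longleftrightarrow> strict_mono_on S F \<or> strict_antimono_on S F"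

definition forts :: "real \<Rightarrow> real \<Rightarrow> (real \<Rightarrow> real) \<Rightarrow> real set" where
  "forts a b F = {x \<in> {a<..<b}.
     \<not> (\<exists>e>0. strictly_monotone_on ({x - e<..<x + e} \<inter> {a..b}) F)}"

definition PM :: "real \<Rightarrow> real \<Rightarrow> (real \<Rightarrow> real) set" where
  "PM a b = {F. continuous_on {a..b} F \<and> F ` {a..b} \<subseteq> {a..b} \<and> finite (forts a b F)}"

text \<open>
  Meaningful for \<open>F \<in> PM a b\<close> and its iterates, which again have finitely many forts.
\<close>

definition num_forts :: "real \<Rightarrow> real \<Rightarrow> (real \<Rightarrow> real) \<Rightarrow> nat" where
  "num_forts a b F = card (forts a b F)"

definition height :: "real \<Rightarrow> real \<Rightarrow> (real \<Rightarrow> real) \<Rightarrow> enat" where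
  "height a b F =
     (if \<exists>i. num_forts a b (F ^^ i) = num_forts a b (F ^^ Suc i)
      then enat (LEAST i. num_forts a b (F ^^ i) = num_forts a b (F ^^ Suc i))
      else \<infinity>)"

text \<open>
  Laps are the closed intervals between consecutive points of \<open>{a, b} \<union> forts a b F\<close>.
\<close>

definition laps :: "real \<Rightarrow> real \<Rightarrow> (real \<Rightarrow> real) \<Rightarrow> real set set" where
  "laps a b F = {{l..r} | l r.
     l \<in> {a, b} \<union> forts a b F \<and> r \<in> {a, b} \<union> forts a b F \<and> l < r \<and>
     {l<..<r} \<inter> forts a b F = {}}"

text \<open>
  The characteristic interval $K(F)$ as a relation.  For $a < b$ and \<open>F \<in> PM a b\<close> there is at most
  one such \<open>K\<close>: two different laps share at most one point, whereas the range of \<open>F\<close> is a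
  nondegenerate interval.
\<close>

definition is_char_interval :: "real \<Rightarrow> real \<Rightarrow> (real \<Rightarrow> real) \<Rightarrow> real set \<Rightarrow> bool" where
  "is_char_interval a b F K \<longleftrightarrow> height a b F = 1 \<and> K \<in> laps a b F \<and> F ` {a..b} \<subseteq> K"

text \<open>
  Here \<open>a'\<close> and \<open>b'\<close> are the endpoints of the characteristic interval $K(F) = [a',b']$.
\<close>

definition char_endpoints_condition ::
    "real \<Rightarrow> real \<Rightarrow> (real \<Rightarrow> real) \<Rightarrow> real \<Rightarrow> real \<Rightarrow> bool" where
  "char_endpoints_condition a b F a' b' \<longleftrightarrow>
     (a' \<in> F ` {a..b} \<longrightarrow> F a' = a') \<and> (b' \<in> F ` {a..b} \<longrightarrow> F b' = b')"

definition is_max_on :: "(real \<Rightarrow> real) \<Rightarrow> real set \<Rightarrow> real \<Rightarrow> bool" where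
  "is_max_on F S m \<longleftrightarrow> m \<in> F ` S \<and> (\<forall>x\<in>S. F x \<le> m)"

definition is_min_on :: "(real \<Rightarrow> real) \<Rightarrow> real set \<Rightarrow> real \<Rightarrow> bool" where
  "is_min_on F S m \<longleftrightarrow> m \<in> F ` S \<and> (\<forall>x\<in>S. m \<le> F x)"

end

theory Submission
  imports Defs "HOL-Analysis.Analysis"
begin

text \<open>
  Write $p = c_k$, $q = c_{k+1}$, $A = c_{k-1}$, $B = c_{k+2}$, $m = F(B)$ and $M = F(A)$.
  Each of (1)--(3) ensures that \<open>F\<close> restricted to $[p,q]$ has a strictly increasing
  iterative root \<open>\<phi>\<close> with $\phi(p) = m$ and $\phi(q) = M$; take \<open>\<phi>\<close> to be the restriction of a
  homeomorphism of the line.  On $[A,B]$ put $f = \phi^{-1} \circ F$.  This is \<open>\<phi>\<close> on $[p,q]$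
  and decreases from \<open>q\<close> to \<open>m\<close> on $[A,p]$ and from \<open>M\<close> to \<open>p\<close> on $[q,B]$, so it has inverses
  $g_L : [m,q] \to [A,p]$ and $g_R : [p,M] \to [q,B]$.  Outside $[A,B]$, \<open>f\<close> is one of
  $g_R \circ F$, $\phi^{-1} \circ F$, $g_L \circ F$: conditions (L) and (R) say that the values of
  \<open>F\<close> lie in the domain required on each piece, and that consecutive pieces meet where \<open>F\<close>
  equals \<open>M\<close> or \<open>m\<close>, at which two of these maps agree.  Always $f(x) \in [A,B]$ and
  $\phi^{-1}(F(f(x))) = F(x)$, whence $f \circ f = F$.

  Since \<open>f\<close> is decreasing on both sides of the fort \<open>A\<close> of \<open>F\<close> but turns at \<open>p\<close>,
  $0 < N(f) < N(f^2)$, while $N(f^2) \le N(f^3) \le N(f^4) = N(F^2) = N(F)$; so $H(f) = 2$.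
\<close>

section \<open>Increasing iterative roots on the line\<close>

definition int_iter :: "('a \<Rightarrow> 'a) \<Rightarrow> int \<Rightarrow> 'a \<Rightarrow> 'a" where
  "int_iter g n = (if 0 \<le> n then g ^^ nat n else inv g ^^ nat (- n))"

lemma int_iter_0 [simp]: "int_iter g 0 x = x"
  by (simp add: int_iter_def)

lemma int_iter_of_nat [simp]: "int_iter g (int n) = g ^^ n"
  by (simp add: int_iter_def)

lemma bij_int_iter: "bij g \<Longrightarrow> bij (int_iter g n)"
  unfolding int_iter_def by (simp add: bij_fn bij_imp_bij_inv)

lemma int_iter_succ:
  assumes "bij g"
  shows "int_iter g (n + 1) x = g (int_iter g n x)"
proof (cases "0 \<le> n")
  case True
  then show ?thesis by (simp add: int_iter_def nat_add_distrib)
next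
  case False
  then have "nat (- n) = Suc (nat (- (n + 1)))"
    by linarith
  moreover have "g (inv g y) = y" for y
    using assms by (simp add: bij_is_surj surj_f_inv_f)
  ultimately show ?thesis
    using False by (auto simp: int_iter_def)
qed

lemma strict_mono_int_iter:
  fixes g :: "'a::linorder \<Rightarrow> 'a"
  assumes "bij g" "strict_mono g"
  shows "strict_mono (int_iter g n)"
proof (induction n rule: int_induct[where k = 0])
  case base
  then show ?case by (simp add: strict_mono_def)
next
  case (step1 i)
  then show ?case
    using assms by (simp add: strict_mono_def int_iter_succ)
next
  case (step2 i)
  have "int_iter g i x = g (int_iter g (i - 1) x)" for x
    using int_iter_succ[OF assms(1), of "i - 1"] by simp
  with step2 show ?case
    by (simp add: strict_mono_def strict_mono_less[OF assms(2)])
qed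

lemma int_iter_mono:
  fixes g :: "'a::linorder \<Rightarrow> 'a"
  assumes "bij g" "\<And>x. x \<le> g x" "i \<le> j"
  shows "int_iter g i x \<le> int_iter g j x"
  using assms(3)
proof (induction j rule: int_ge_induct)
  case (step j)
  then show ?case
    using assms(2)[of "int_iter g j x"] by (simp add: int_iter_succ[OF assms(1)])
qed simp

text \<open>Lets a bound on the forward iterate \<open>(g ^^ n) x\<close> be pulled back to a bound
  on \<open>x\<close> by a negative iterate.\<close>

lemma funpow_int_iter_minus:
  assumes "bij g"
  shows "(g ^^ n) (int_iter g (- int n) x) = x"
proof -
  have "int_iter g (- int n) = inv g ^^ n"
    by (cases "n = 0") (simp_all add: int_iter_def)
  moreover have "(g ^^ n) ((inv g ^^ n) x) = x" for x
  proof (induction n arbitrary: x)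
    case (Suc n)
    have "(g ^^ Suc n) ((inv g ^^ Suc n) x) = g ((g ^^ n) ((inv g ^^ n) (inv g x)))"
      by (simp add: funpow_swap1)
    then show ?case
      using Suc assms by (simp add: bij_is_surj surj_f_inv_f)
  qed simp
  ultimately show ?thesis by simp
qed

lemma strict_mono_funpow:
  fixes g :: "'a::linorder \<Rightarrow> 'a"
  assumes "strict_mono g"
  shows "strict_mono (g ^^ n)"
  using assms by (induction n) (simp_all add: strict_mono_def)

lemma le_funpow:
  fixes g :: "'a::linorder \<Rightarrow> 'a"
  assumes "\<And>x. x \<le> g x" "i \<le> j"
  shows "(g ^^ i) x \<le> (g ^^ j) x"
  using assms(2)
proof (induction j rule: dec_induct)
  case (step j)
  then show ?case
    using assms(1)[of "(g ^^ j) x"] by simp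
qed simp

text \<open>
  For a homeomorphism \<open>g \<ge> id\<close> of the line, the classes of this relation are the fixed points of
  \<open>g\<close> and the components of the set where \<open>g x > x\<close>.
\<close>

definition orbit_linked :: "(real \<Rightarrow> real) \<Rightarrow> real \<Rightarrow> real \<Rightarrow> bool" where
  "orbit_linked g x y \<longleftrightarrow> (\<exists>n. x \<le> (g ^^ n) y \<and> y \<le> (g ^^ n) x)"

section \<open>Square roots of homeomorphisms lying above the identity\<close>

locale expanding_homeo =
  fixes g :: "real \<Rightarrow> real"
  assumes strict_mono: "strict_mono g" and surj: "surj g" and ge: "x \<le> g x"
begin

lemma bij: "bij g"
  using strict_mono surj by (simp add: bij_def strict_mono_imp_inj_on)

lemma linked_refl: "orbit_linked g x x"
  unfolding orbit_linked_def by (rule exI[of _ 0]) simp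

lemma linked_sym: "orbit_linked g x y \<Longrightarrow> orbit_linked g y x"
  unfolding orbit_linked_def by blast

lemma linked_trans:
  assumes "orbit_linked g x y" "orbit_linked g y z"
  shows "orbit_linked g x z"
proof -
  obtain i where i: "x \<le> (g ^^ i) y" "y \<le> (g ^^ i) x"
    using assms(1) unfolding orbit_linked_def by blast
  obtain j where j: "y \<le> (g ^^ j) z" "z \<le> (g ^^ j) y"
    using assms(2) unfolding orbit_linked_def by blast
  have mono: "mono (g ^^ n)" for n
    by (intro strict_mono_mono strict_mono_funpow strict_mono)
  have "x \<le> (g ^^ (i + j)) z"
    using i(1) monoD[OF mono j(1), of i] by (simp add: funpow_add)
  moreover have "z \<le> (g ^^ (i + j)) x"
    using j(2) monoD[OF mono i(2), of j] by (simp add: funpow_add add.commute[of i])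
  ultimately show ?thesis
    unfolding orbit_linked_def by blast
qed

text \<open>A fixed point forms a class of its own: all iterates fix \<open>x\<close>, so one half
  of the link reads \<open>y \<le> x\<close>, and the other half gives \<open>x \<le> y\<close>
  after cancelling \<open>g ^^ n\<close>.\<close>

lemma linked_fixed:
  assumes "orbit_linked g x y" "g x = x"
  shows "y = x"
proof -
  have fix_iter: "(g ^^ n) x = x" for n
    by (induction n) (simp_all add: assms(2))
  obtain n where n: "x \<le> (g ^^ n) y" "y \<le> x"
    using assms(1) fix_iter unfolding orbit_linked_def by auto
  have "(g ^^ n) x \<le> (g ^^ n) y"
    using n(1) fix_iter by simp
  then show ?thesis
    using n(2) strict_mono_less_eq[OF strict_mono_funpow[OF strict_mono]] by (metis order_antisym)
qed

text \<open>Distinct classes lie in order as blocks. If \<open>y' \<le> x'\<close>, then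
  \<open>y\<close> is at most an iterate of \<open>y'\<close>, hence of \<open>x'\<close>, hence of
  \<open>x\<close>, which would link \<open>x\<close> and \<open>y\<close>.\<close>

lemma linked_separated:
  assumes "x < y" "\<not> orbit_linked g x y" "orbit_linked g x x'" "orbit_linked g y y'"
  shows "x' < y'"
proof (rule ccontr)
  assume "\<not> x' < y'"
  obtain i where i: "x' \<le> (g ^^ i) x"
    using assms(3) unfolding orbit_linked_def by blast
  obtain j where j: "y \<le> (g ^^ j) y'"
    using assms(4) unfolding orbit_linked_def by blast
  have mono: "mono (g ^^ n)" for n
    by (intro strict_mono_mono strict_mono_funpow strict_mono)
  have "y \<le> (g ^^ j) ((g ^^ i) x)"
    using j monoD[OF mono, of y' "(g ^^ i) x" j] i \<open>\<not> x' < y'\<close> by linarith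
  then have "y \<le> (g ^^ (j + i)) x"
    by (simp add: funpow_add)
  moreover have "x \<le> (g ^^ (j + i)) y"
    using assms(1) le_funpow[OF ge, of 0 "j + i" y] by simp
  ultimately show False
    using assms(2) unfolding orbit_linked_def by blast
qed

text \<open>The half-open intervals from one integer iterate of \<open>x0\<close> to the next are
  fundamental domains; this says that they tile the class of \<open>x0\<close>.\<close>

lemma linked_iff_int_iter:
  assumes "x0 < g x0"
  shows "orbit_linked g x0 x \<longleftrightarrow> (\<exists>n. int_iter g n x0 \<le> x \<and> x < int_iter g (n + 1) x0)"
proof
  assume "orbit_linked g x0 x"
  then obtain n where n: "x0 \<le> (g ^^ n) x" "x \<le> (g ^^ n) x0"
    unfolding orbit_linked_def by blast
  have "(g ^^ n) (int_iter g (- int n) x0) \<le> (g ^^ n) x"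
    using n(1) by (simp add: funpow_int_iter_minus[OF bij])
  then have low: "int_iter g (- int n) x0 \<le> x"
    using strict_mono_less_eq[OF strict_mono_funpow[OF strict_mono]] by blast
  have "(g ^^ n) x0 < (g ^^ n) (g x0)"
    using strict_mono_less[OF strict_mono_funpow[OF strict_mono]] assms by blast
  then have up: "x < int_iter g (int (Suc n)) x0"
    using n(2) unfolding int_iter_of_nat by (simp add: funpow_swap1)
  show "\<exists>n. int_iter g n x0 \<le> x \<and> x < int_iter g (n + 1) x0"
  \<comment> \<open>If no interval catches \<open>x\<close>, the lower bound passes from each
    iterate to the next, beyond the iterate already known to exceed \<open>x\<close>.\<close>
  proof (rule ccontr)
    assume none: "\<not> ?thesis"
    have "int_iter g j x0 \<le> x" if "- int n \<le> j" for j
      using that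
    proof (induction j rule: int_ge_induct)
      case base
      show ?case by (rule low)
    next
      case (step j)
      then show ?case using none by force
    qed
    from this[of "int (Suc n)"] up show False by simp
  qed
next
  assume "\<exists>n. int_iter g n x0 \<le> x \<and> x < int_iter g (n + 1) x0"
  then obtain n where n: "int_iter g n x0 \<le> x" "x < int_iter g (n + 1) x0"
    by blast
  define N where "N = nat (\<bar>n\<bar> + 1)"
  have "x \<le> int_iter g (int N) x0"
    using n(2) int_iter_mono[OF bij ge, of "n + 1" "int N" x0] abs_ge_self[of n]
    unfolding N_def by linarith
  moreover have "int_iter g (- int N) x0 \<le> x"
    using n(1) int_iter_mono[OF bij ge, of "- int N" n x0] unfolding N_def by linarith
  then have "(g ^^ N) (int_iter g (- int N) x0) \<le> (g ^^ N) x"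
    using strict_mono_less_eq[OF strict_mono_funpow[OF strict_mono]] by blast
  then have "x0 \<le> (g ^^ N) x"
    by (simp add: funpow_int_iter_minus[OF bij])
  ultimately show "orbit_linked g x0 x"
    unfolding orbit_linked_def by auto
qed

text \<open>The inverse of an Abel function of \<open>g\<close>: it conjugates \<open>g\<close> on a component to the unit shift.\<close>

lemma abel_chart:
  assumes "x0 < y0" "y0 < g x0"
  obtains e :: "real \<Rightarrow> real" where "strict_mono e" "\<And>t. e (t + 1) = g (e t)" "e 0 = x0" "e (1/2) = y0"
    "range e = {x. orbit_linked g x0 x}"
proof -
  \<comment> \<open>Piecewise linear parametrization of the fundamental domain from
    \<open>x0\<close> to \<open>g x0\<close>, bent at 1/2 so as to pass through the prescribed point
    \<open>y0\<close> there.\<close>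
  define u where "u s = (if s \<le> 1/2 then x0 + 2 * s * (y0 - x0)
    else y0 + (2 * s - 1) * (g x0 - y0))" for s :: real
  have u_mono: "u s < u t" if "s < t" for s t
  proof -
    have "2 * s * (y0 - x0) < 2 * t * (y0 - x0)" "(2 * s - 1) * (g x0 - y0) < (2 * t - 1) * (g x0 - y0)"
      using that assms by (simp_all add: mult_strict_right_mono)
    moreover have "2 * s * (y0 - x0) \<le> y0 - x0" if "s \<le> 1/2"
      using that assms mult_right_mono[of "2 * s" 1 "y0 - x0"] by simp
    moreover have "0 < (2 * t - 1) * (g x0 - y0)" if "\<not> t \<le> 1/2"
      using that assms by simp
    ultimately show ?thesis
      using that by (auto simp: u_def)
  qed
  have u_vals [simp]: "u 0 = x0" "u 1 = g x0" "u (1/2) = y0"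
    by (simp_all add: u_def)
  have u_range: "x0 \<le> u (frac t)" "u (frac t) < g x0" for t
    using u_mono[of 0 "frac t"] u_mono[of "frac t" 1] frac_ge_0[of t] frac_lt_1[of t]
    by (metis less_eq_real_def u_vals(1)) (metis u_vals(2) u_mono frac_lt_1)
  have u_surj: "\<exists>s. 0 \<le> s \<and> s < 1 \<and> u s = y" if "x0 \<le> y" "y < g x0" for y
  proof (cases "y \<le> y0")
    case True
    with that assms show ?thesis
      by (intro exI[of _ "(y - x0) / (2 * (y0 - x0))"]) (auto simp: u_def field_simps)
  next
    case False
    with that assms show ?thesis
      by (intro exI[of _ "1/2 + (y - y0) / (2 * (g x0 - y0))"]) (auto simp: u_def field_simps)
  qed
  \<comment> \<open>The integer part of \<open>t\<close> selects the fundamental domain and the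
    fractional part the position in it.\<close>
  define e where "e t = int_iter g \<lfloor>t\<rfloor> (u (frac t))" for t
  note it_mono = strict_mono_int_iter[OF bij strict_mono]
  have e_ge: "int_iter g \<lfloor>t\<rfloor> x0 \<le> e t" for t
    unfolding e_def using u_range strict_mono_less_eq[OF it_mono] by blast
  \<comment> \<open>Here the extra factor \<open>g\<close> sits inside the iterate, not outside: the
    image of the domain's right end \<open>g x0\<close> is the left end of the next domain.\<close>
  have it_succ: "int_iter g (n + 1) x0 = int_iter g n (g x0)" for n
  proof (induction n rule: int_induct[where k = 0])
    case base
    then show ?case by (simp add: int_iter_succ[OF bij, of 0, simplified])
  next
    case (step1 i)
    then show ?case by (simp only: int_iter_succ[OF bij])
  next
    case (step2 i)
    have "g (int_iter g (i - 1 + 1) x0) = g (int_iter g (i - 1) (g x0))"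
      using step2 int_iter_succ[OF bij, of "i - 1"] int_iter_succ[OF bij, of i] by simp
    then show ?case
      using bij_is_inj[OF bij] by (meson injD)
  qed
  have e_less: "e t < int_iter g (\<lfloor>t\<rfloor> + 1) x0" for t
    unfolding e_def it_succ using u_range strict_mono_less[OF it_mono] by blast
  have e_mono: "e s < e t" if "s < t" for s t
  proof (cases "\<lfloor>s\<rfloor> = \<lfloor>t\<rfloor>")
    case True
    with that have "frac s < frac t" by (simp add: frac_def)
    then show ?thesis
      unfolding e_def True using u_mono strict_mono_less[OF it_mono] by blast
  next
    case False
    with that have "\<lfloor>s\<rfloor> + 1 \<le> \<lfloor>t\<rfloor>"
      using floor_mono[of s t] by linarith
    then show ?thesis
      using e_less[of s] e_ge[of t] int_iter_mono[OF bij ge, of "\<lfloor>s\<rfloor> + 1" "\<lfloor>t\<rfloor>" x0] by linarith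
  qed
  have "range e = {x. orbit_linked g x0 x}"
  proof (intro equalityI subsetI)
    fix x assume "x \<in> range e"
    then show "x \<in> {x. orbit_linked g x0 x}"
      using linked_iff_int_iter[of x0 x] assms e_ge e_less by fastforce
  next
    fix x assume "x \<in> {x. orbit_linked g x0 x}"
    then obtain n where n: "int_iter g n x0 \<le> x" "x < int_iter g n (g x0)"
      using linked_iff_int_iter[of x0 x] assms it_succ by auto
    obtain y where y: "int_iter g n y = x"
      using bij_int_iter[OF bij] by (metis bij_pointE)
    then have "x0 \<le> y" "y < g x0"
      using n strict_mono_less[OF it_mono] strict_mono_less_eq[OF it_mono] by blast+
    then obtain s where s: "0 \<le> s" "s < 1" "u s = y"
      using u_surj by blast
    have "\<lfloor>of_int n + s\<rfloor> = n"
      using s by linarith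
    then have "e (of_int n + s) = x"
      unfolding e_def using s y by (simp add: frac_def)
    then show "x \<in> range e" by blast
  qed
  moreover have "e (t + 1) = g (e t)" for t
    by (simp add: e_def frac_def int_iter_succ[OF bij])
  moreover have "e 0 = x0" "e (1/2) = y0"
    using u_vals by (simp_all add: e_def frac_def del: u_vals)
  ultimately show ?thesis
    using that[of e] e_mono by (auto simp: strict_mono_def)
qed

text \<open>In the chart of \<open>abel_chart\<close> the map \<open>g\<close> is the shift by 1, so
  the shift by 1/2 is a square root; it sends \<open>x0\<close>, at parameter 0, to
  \<open>y0\<close>, at parameter 1/2.\<close>

lemma sqrt_on_class:
  assumes "x0 < y0" "y0 < g x0"
  shows "\<exists>\<psi>. \<psi> x0 = y0 \<and> strict_mono_on {x. orbit_linked g x0 x} \<psi> \<and>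
    (\<forall>x. orbit_linked g x0 x \<longrightarrow> orbit_linked g x0 (\<psi> x) \<and> \<psi> (\<psi> x) = g x)"
proof -
  obtain e :: "real \<Rightarrow> real" where e: "strict_mono e" "\<And>t. e (t + 1) = g (e t)" "e 0 = x0"
    "e (1/2) = y0" "range e = {x. orbit_linked g x0 x}"
    using abel_chart[OF assms] by blast
  have inv_e: "inv e (e t) = t" for t
    using e(1) by (simp add: strict_mono_imp_inj_on)
  define \<psi> where "\<psi> x = e (inv e x + 1/2)" for x
  have \<psi>_e: "\<psi> (e t) = e (t + 1/2)" for t
    by (simp add: \<psi>_def inv_e)
  have "\<psi> x0 = y0"
    using \<psi>_e[of 0] e(3,4) by simp
  moreover have "strict_mono_on {x. orbit_linked g x0 x} \<psi>"
    unfolding e(5)[symmetric] using strict_mono_less[OF e(1)]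
    by (auto simp: strict_mono_on_def \<psi>_e)
  moreover have "orbit_linked g x0 (\<psi> x) \<and> \<psi> (\<psi> x) = g x" if linked: "orbit_linked g x0 x" for x
  proof -
    obtain t where t: "x = e t"
      using linked e(5) by blast
    have "\<psi> x \<in> range e"
      by (simp add: t \<psi>_e)
    moreover have "\<psi> (\<psi> x) = e (t + 1)"
      by (simp add: t \<psi>_e add.assoc)
    ultimately show ?thesis
      using e(2,5) t by simp
  qed
  ultimately show ?thesis by blast
qed

text \<open>Roots on the separate classes are patched together, each built from a chosen
  representative. Since classes are ordered blocks and each root preserves its class, the result is
  increasing.\<close>

lemma increasing_sqrt:
  "\<exists>\<phi>. strict_mono \<phi> \<and> (\<forall>x. \<phi> (\<phi> x) = g x) \<and> (p < m \<and> m < g p \<longrightarrow> \<phi> p = m)"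
proof -
  \<comment> \<open>The image intended for each possible base point: \<open>m\<close> for
    \<open>p\<close> when admissible, and otherwise the midpoint, an arbitrary choice strictly
    between \<open>x\<close> and \<open>g x\<close>.\<close>
  define y where "y x = (if x = p \<and> p < m \<and> m < g p then m else (x + g x) / 2)" for x
  have y: "x < y x" "y x < g x" if "x < g x" for x
    using that by (auto simp: y_def)
  have "\<forall>x0. \<exists>\<psi>. x0 < g x0 \<longrightarrow> \<psi> x0 = y x0 \<and>
    strict_mono_on {x. orbit_linked g x0 x} \<psi> \<and>
    (\<forall>x. orbit_linked g x0 x \<longrightarrow> orbit_linked g x0 (\<psi> x) \<and> \<psi> (\<psi> x) = g x)"
    using sqrt_on_class[OF y] by blast
  then obtain \<psi> where "\<And>x0. x0 < g x0 \<Longrightarrow> \<psi> x0 x0 = y x0 \<and>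
    strict_mono_on {x. orbit_linked g x0 x} (\<psi> x0) \<and>
    (\<forall>x. orbit_linked g x0 x \<longrightarrow> orbit_linked g x0 (\<psi> x0 x) \<and> \<psi> x0 (\<psi> x0 x) = g x)"
    by metis
  then have \<psi>_base: "\<psi> x0 x0 = y x0"
    and \<psi>_mono: "strict_mono_on {x. orbit_linked g x0 x} (\<psi> x0)"
    and \<psi>_linked: "orbit_linked g x0 x \<Longrightarrow> orbit_linked g x0 (\<psi> x0 x)"
    and \<psi>_sq: "orbit_linked g x0 x \<Longrightarrow> \<psi> x0 (\<psi> x0 x) = g x" if "x0 < g x0" for x0 x
    using that by blast+
  \<comment> \<open>Preferring \<open>p\<close> as the representative of its own class makes the
    prescribed value at \<open>p\<close> survive the patching.\<close>
  define r where "r x = (if orbit_linked g x p then p else (SOME z. orbit_linked g x z))" for x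
  have r_linked: "orbit_linked g (r x) x" for x
    unfolding r_def using linked_sym linked_refl someI[of "orbit_linked g x" x] by auto
  have r_eq: "r x = r x'" if "orbit_linked g x x'" for x x'
  proof -
    have "orbit_linked g x = orbit_linked g x'"
      using that linked_trans linked_sym by blast
    then show ?thesis by (simp add: r_def)
  qed
  define \<phi> where "\<phi> x = (if g x = x then x else \<psi> (r x) x)" for x
  have r_less: "r x < g (r x)" if "g x \<noteq> x" for x
  proof -
    have "g (r x) \<noteq> r x"
      using linked_fixed[OF r_linked[of x]] that by metis
    then show ?thesis using ge[of "r x"] by simp
  qed
  have \<phi>_linked: "orbit_linked g x (\<phi> x)" for x
    unfolding \<phi>_def
    using linked_refl linked_trans[OF linked_sym[OF r_linked] \<psi>_linked[OF r_less r_linked]] by auto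
  have sq: "\<phi> (\<phi> x) = g x" for x
  proof (cases "g x = x")
    case True
    then show ?thesis by (simp add: \<phi>_def)
  next
    case False
    have "g (\<phi> x) \<noteq> \<phi> x"
      using linked_fixed[OF linked_sym[OF \<phi>_linked[of x]]] False by auto
    then show ?thesis
      using False r_eq[OF \<phi>_linked[of x], symmetric] \<psi>_sq[OF r_less[OF False] r_linked] by (simp add: \<phi>_def)
  qed
  have "\<phi> x < \<phi> x'" if "x < x'" for x x'
  proof (cases "orbit_linked g x x'")
    case True
    have "g x \<noteq> x"
      using linked_fixed[OF True] that by auto
    moreover have "\<psi> (r x) x < \<psi> (r x) x'"
      using \<psi>_mono[OF r_less[OF \<open>g x \<noteq> x\<close>]] that r_linked[of x] r_linked[of x'] r_eq[OF True]
      by (simp add: strict_mono_on_def)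
    moreover have "g x' \<noteq> x'"
      using linked_fixed[OF linked_sym[OF True]] that by auto
    ultimately show ?thesis
      using r_eq[OF True] by (simp add: \<phi>_def)
  next
    case False
    then show ?thesis
      using linked_separated[OF that] \<phi>_linked by blast
  qed
  moreover have "\<phi> p = m" if "p < m \<and> m < g p"
  proof -
    have "r p = p" by (simp add: r_def linked_refl)
    then show ?thesis
      using that \<psi>_base[of p] by (simp add: \<phi>_def y_def)
  qed
  ultimately show ?thesis
    using sq by (intro exI[of _ \<phi>]) (auto simp: strict_mono_def)
qed

end

text \<open>If \<open>\<phi>\<close> moved \<open>x\<close> in one direction, a second application
  would move it further in the same direction, away from \<open>x\<close>.\<close>

lemma sqrt_fixed:
  fixes \<phi> g :: "'a::linorder \<Rightarrow> 'a"
  assumes "strict_mono \<phi>" "\<And>x. \<phi> (\<phi> x) = g x" "g x = x"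
  shows "\<phi> x = x"
  using assms strict_monoD[OF assms(1), of x "\<phi> x"] strict_monoD[OF assms(1), of "\<phi> x" x]
  by (metis less_asym' linorder_less_linear)

lemma surj_of_square:
  assumes "\<And>x. \<phi> (\<phi> x) = g x" "surj g"
  shows "surj \<phi>"
  using assms by (metis surj_def)

text \<open>The parts of \<open>g\<close> above and below the identity are treated separately:
  \<open>g1\<close> keeps the first, and \<open>g2\<close> keeps the inverse of the second. Both lie
  above the identity, and the wanted root composes a root of \<open>g1\<close> with the inverse of a
  root of \<open>g2\<close>.\<close>

theorem homeo_increasing_sqrt:
  fixes g :: "real \<Rightarrow> real"
  assumes "strict_mono g" "surj g"
    and p: "p < m \<and> m < g p \<or> m = p \<and> g p = p"
    and q: "g q < M \<and> M < q \<or> M = q \<and> g q = q"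
  obtains \<phi> where "strict_mono \<phi>" "surj \<phi>" "\<And>x. \<phi> (\<phi> x) = g x" "\<phi> p = m" "\<phi> q = M"
proof -
  have bij: "bij g"
    using assms(1,2) by (simp add: bij_def strict_mono_imp_inj_on)
  have inv_g: "inv g (g x) = x" "g (inv g x) = x" for x
    using bij by (simp_all add: bij_is_inj bij_is_surj surj_f_inv_f)
  have inv_mono: "strict_mono (inv g)"
    by (rule strict_mono_inv[OF assms(1,2) inv_g(1)])
  define g1 where "g1 x = max x (g x)" for x
  define g2 where "g2 x = max x (inv g x)" for x
  have less_iff: "x < inv g y \<longleftrightarrow> g x < y" "inv g y < x \<longleftrightarrow> y < g x" for x y
    using strict_mono_less[OF assms(1), of x "inv g y"] strict_mono_less[OF assms(1), of "inv g y" x]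
    by (simp_all add: inv_g)
  have g1_surj: "surj g1"
  proof (rule surjI)
    fix y show "g1 (if inv g y \<le> y then inv g y else y) = y"
      using less_iff[of y y] by (auto simp: g1_def inv_g)
  qed
  have "g1 x < g1 y" if "x < y" for x y
    using that strict_monoD[OF assms(1) that] by (simp add: g1_def less_max_iff_disj) linarith
  then have g1_mono: "strict_mono g1"
    by (simp add: strict_mono_def)
  interpret G1: expanding_homeo g1
    using g1_surj g1_mono
    by unfold_locales (auto simp: g1_def)
  have g2_surj: "surj g2"
  proof (rule surjI)
    fix y show "g2 (if g y \<le> y then g y else y) = y"
      using less_iff[of y y] by (auto simp: g2_def inv_g)
  qed
  have "g2 x < g2 y" if "x < y" for x y
    using that strict_monoD[OF inv_mono that] by (simp add: g2_def less_max_iff_disj) linarith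
  then have g2_mono: "strict_mono g2"
    by (simp add: strict_mono_def)
  interpret G2: expanding_homeo g2
    using g2_surj g2_mono
    by unfold_locales (auto simp: g2_def)
  obtain \<phi>1 where \<phi>1: "strict_mono \<phi>1" "\<And>x. \<phi>1 (\<phi>1 x) = g1 x" "p < m \<and> m < g1 p \<Longrightarrow> \<phi>1 p = m"
    using G1.increasing_sqrt[of p m] by blast
  \<comment> \<open>The prescription is reversed, \<open>M\<close> to \<open>q\<close>, because the
    inverse of \<open>\<psi>\<close> is what will be used.\<close>
  obtain \<psi> where \<psi>: "strict_mono \<psi>" "\<And>x. \<psi> (\<psi> x) = g2 x" "M < q \<and> q < g2 M \<Longrightarrow> \<psi> M = q"
    using G2.increasing_sqrt[of M q] by blast
  have surj: "surj \<phi>1" "surj \<psi>"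
    using surj_of_square[OF \<phi>1(2) g1_surj] surj_of_square[OF \<psi>(2) g2_surj] by auto
  define \<phi>2 where "\<phi>2 = inv \<psi>"
  have \<phi>2: "\<phi>2 (\<psi> x) = x" "\<psi> (\<phi>2 x) = x" for x
    using surj(2) \<psi>(1) by (simp_all add: \<phi>2_def strict_mono_imp_inj_on surj_f_inv_f)
  have \<phi>2_mono: "strict_mono \<phi>2"
    by (rule strict_mono_inv[OF \<psi>(1) surj(2) \<phi>2(1)])
  have \<phi>1_fix: "\<phi>1 x = x" if "g x \<le> x" for x
    by (rule sqrt_fixed[OF \<phi>1(1,2)]) (use that in \<open>simp add: g1_def\<close>)
  have \<phi>2_fix: "\<phi>2 x = x" if "x \<le> g x" for x
  proof -
    have "\<not> x < inv g x" using that less_iff by force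
    then have "\<psi> x = x"
      by (intro sqrt_fixed[OF \<psi>(1,2)]) (simp add: g2_def)
    then show ?thesis using \<phi>2(1)[of x] by simp
  qed
  have \<phi>2_sq: "\<phi>2 (\<phi>2 x) = g x" if "g x \<le> x" for x
  proof -
    have "g2 (g x) = x"
      using that by (simp add: g2_def inv_g)
    then have "\<psi> (\<psi> (g x)) = x"
      using \<psi>(2) by simp
    then show ?thesis using \<phi>2(1) by metis
  qed
  define \<phi> where "\<phi> x = \<phi>1 (\<phi>2 x)" for x
  have "strict_mono \<phi>"
    using \<phi>1(1) \<phi>2_mono by (simp add: \<phi>_def strict_mono_def)
  moreover have "\<phi> (\<phi> x) = g x" for x
  proof (cases "x \<le> g x")
    case True
    \<comment> \<open>This keeps \<open>\<phi>1 x\<close> in the region that \<open>\<phi>2\<close>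
      fixes, so \<open>\<phi>\<close> acts as \<open>\<phi>1\<close> twice. It holds since
      \<open>\<phi>1\<close> commutes with its square \<open>g1\<close>.\<close>
    have "\<phi>1 x \<le> g (\<phi>1 x)"
    proof (cases "g x = x")
      case False
      have "\<phi>1 x < \<phi>1 (g1 x)"
        using True False strict_monoD[OF \<phi>1(1)] by (simp add: g1_def)
      also have "\<phi>1 (g1 x) = g1 (\<phi>1 x)"
        by (simp flip: \<phi>1(2))
      finally show ?thesis by (auto simp: g1_def)
    qed (simp add: \<phi>1_fix)
    then show ?thesis
      using True \<phi>2_fix \<phi>1(2)[of x] by (simp add: \<phi>_def g1_def)
  next
    case False
    \<comment> \<open>The counterpart: \<open>\<phi>1\<close> must fix \<open>\<phi>2 x\<close>.
      Otherwise \<open>\<phi>2\<close> would fix \<open>\<phi>2 x\<close>, and so, being injective,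
      \<open>x\<close> itself.\<close>
    have "g (\<phi>2 x) \<le> \<phi>2 x"
    proof (rule ccontr)
      assume "\<not> ?thesis"
      then have "\<phi>2 (\<phi>2 x) = \<phi>2 x" by (simp add: \<phi>2_fix)
      then have "\<phi>2 x = x" by (metis \<phi>2(2))
      with \<open>\<not> ?thesis\<close> False show False by simp
    qed
    moreover have "g (g x) \<le> g x"
      using False strict_mono_less_eq[OF assms(1), of "g x" x] by simp
    ultimately show ?thesis
      using False \<phi>1_fix \<phi>2_sq by (simp add: \<phi>_def)
  qed
  moreover have "\<phi> p = m"
    using p \<phi>2_fix[of p] \<phi>1_fix[of p] \<phi>1(3) by (auto simp: \<phi>_def g1_def)
  moreover have "\<phi> q = M"
    using q
  proof
    assume M: "g q < M \<and> M < q"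
    then have "q < g2 M"
      using less_iff[of q M] by (simp add: g2_def)
    then have "\<phi>2 q = M"
      using M \<psi>(3) \<phi>2(1)[of M] by simp
    moreover have "g M < M"
      using M strict_monoD[OF assms(1), of M q] by linarith
    ultimately show ?thesis
      by (simp add: \<phi>_def \<phi>1_fix)
  qed (simp add: \<phi>_def \<phi>1_fix \<phi>2_fix)
  ultimately show ?thesis
    using that[of \<phi>] surj_of_square[of \<phi> g, OF _ assms(2)] by blast
qed

text \<open>Extending \<open>F\<close> by translations beyond both ends gives a homeomorphism of the
  line, to which the previous theorem applies.\<close>

lemma interval_increasing_sqrt:
  fixes F :: "real \<Rightarrow> real"
  assumes "p \<le> q" "continuous_on {p..q} F" "strict_mono_on {p..q} F"
    and p: "p < m \<and> m < F p \<or> m = p \<and> F p = p"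
    and q: "F q < M \<and> M < q \<or> M = q \<and> F q = q"
  obtains \<phi> where "strict_mono \<phi>" "surj \<phi>" "\<And>x. x \<in> {p..q} \<Longrightarrow> \<phi> (\<phi> x) = F x"
    "\<phi> p = m" "\<phi> q = M"
proof -
  \<comment> \<open>\<open>cl\<close> is the nearest-point projection onto \<open>{p..q}\<close>, so
    \<open>x - cl x\<close> vanishes inside and measures the signed overshoot outside.\<close>
  define cl where "cl x = max p (min q x)" for x
  define g where "g x = F (cl x) + (x - cl x)" for x
  have g_in: "g x = F x" if "x \<in> {p..q}" for x
    using that by (simp add: g_def cl_def)
  have cl_mono: "cl x < cl y \<and> y - cl y \<ge> x - cl x \<or> cl x = cl y" if "x < y" for x y
    using that assms(1) by (auto simp: cl_def max_def min_def)
  have cl_in: "cl x \<in> {p..q}" for x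
    using assms(1) by (simp add: cl_def)
  have "g x < g y" if "x < y" for x y
    using cl_mono[OF that] strict_mono_onD[OF assms(3) cl_in cl_in, of x y] that
    unfolding g_def by force
  then have "strict_mono g"
    by (simp add: strict_mono_def)
  moreover have "\<exists>x. g x = y" for y
  proof -
    consider "y < F p" | "F q < y" | "F p \<le> y" "y \<le> F q"
      by linarith
    then show ?thesis
    proof cases
      case 1
      then show ?thesis
        using assms(1) by (intro exI[of _ "p + (y - F p)"]) (simp add: g_def cl_def max_def min_def)
    next
      case 2
      then show ?thesis
        using assms(1) by (intro exI[of _ "q + (y - F q)"]) (simp add: g_def cl_def max_def min_def)
    next
      case 3
      then show ?thesis
        using IVT'[of F p y q] assms(1,2) g_in by force
    qed
  qed
  then have "surj g"
    by (metis surj_def)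
  moreover have "p < m \<and> m < g p \<or> m = p \<and> g p = p" "g q < M \<and> M < q \<or> M = q \<and> g q = q"
    using p q g_in assms(1) by auto
  ultimately obtain \<phi> where \<phi>: "strict_mono \<phi>" "surj \<phi>" "\<And>x. \<phi> (\<phi> x) = g x" "\<phi> p = m" "\<phi> q = M"
    using homeo_increasing_sqrt[of g p m q M] by blast
  show ?thesis
    by (rule that[of \<phi>]) (simp_all add: \<phi> g_in)
qed

text \<open>A monotone map that omits no value cannot jump. Thus continuity of the roots comes for
  free and was not tracked in their construction.\<close>

lemma strict_mono_surj_continuous:
  fixes f :: "real \<Rightarrow> real"
  assumes "strict_mono f" "surj f"
  shows "continuous_on S f"
proof -
  have "continuous_on UNIV f"
    using assms by (intro continuous_onI_mono) (auto simp: strict_mono_less_eq)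
  then show ?thesis
    using continuous_on_subset by blast
qed

section \<open>Forts and height\<close>

lemma strict_mono_on_Icc_join:
  fixes f :: "real \<Rightarrow> real"
  assumes "strict_mono_on {l..x} f" "strict_mono_on {x..r} f"
  shows "strict_mono_on {l..r} f"
proof (rule strict_mono_onI)
  fix y z assume yz: "y \<in> {l..r}" "z \<in> {l..r}" "y < z"
  show "f y < f z"
  proof (cases "y < x \<and> x < z")
    case True
    then have "f y < f x" "f x < f z"
      using yz by (auto intro: strict_mono_onD[OF assms(1)] strict_mono_onD[OF assms(2)])
    then show ?thesis by simp
  next
    case False
    then have "z \<le> x \<or> x \<le> y" by linarith
    then show ?thesis
      using yz by (auto intro: strict_mono_onD[OF assms(1)] strict_mono_onD[OF assms(2)])
  qed
qed

lemma strict_antimono_on_uminus_iff: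
  fixes f :: "real \<Rightarrow> real"
  shows "strict_antimono_on S f \<longleftrightarrow> strict_mono_on S (\<lambda>x. - f x)"
  by (simp add: monotone_on_def)

lemma strict_antimono_on_Icc_join:
  fixes f :: "real \<Rightarrow> real"
  assumes "strict_antimono_on {l..x} f" "strict_antimono_on {x..r} f"
  shows "strict_antimono_on {l..r} f"
  using assms strict_mono_on_Icc_join[of l x "\<lambda>x. - f x" r]
  unfolding strict_antimono_on_uminus_iff by blast

lemma not_fort_of_strictly_monotone:
  assumes "strictly_monotone_on {l..r} f" "l < x" "x < r"
  shows "x \<notin> forts a b f"
proof -
  define e where "e = min (x - l) (r - x)"
  have "0 < e" "{x - e<..<x + e} \<inter> {a..b} \<subseteq> {l..r}"
    using assms(2,3) by (auto simp: e_def)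
  then have "strictly_monotone_on ({x - e<..<x + e} \<inter> {a..b}) f"
    using assms(1) monotone_on_subset unfolding strictly_monotone_on_def by blast
  then show ?thesis
    using \<open>0 < e\<close> by (auto simp: forts_def)
qed

text \<open>For continuous real maps on an interval, strict monotonicity is injectivity, which is
  the form that passes through compositions.\<close>

lemma forts_iff_not_inj:
  assumes "continuous_on {a..b} f"
  shows "x \<in> forts a b f \<longleftrightarrow>
    x \<in> {a<..<b} \<and> \<not> (\<exists>e>0. inj_on f ({x - e<..<x + e} \<inter> {a..b}))"
proof -
  have "inj_on f ({x - e<..<x + e} \<inter> {a..b}) \<longleftrightarrow>
    strictly_monotone_on ({x - e<..<x + e} \<inter> {a..b}) f" for e
    unfolding strictly_monotone_on_def
    by (intro injective_eq_monotone_map is_interval_Int is_interval_oo is_interval_cc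
        continuous_on_subset[OF assms]) auto
  then show ?thesis by (simp add: forts_def)
qed

text \<open>If \<open>h \<circ> f\<close> is injective near a point, then so is \<open>f\<close>,
  whatever the outer map \<open>h\<close> is.\<close>

lemma forts_subset_of_comp:
  assumes "continuous_on {a..b} f" "continuous_on {a..b} F" "\<And>x. x \<in> {a..b} \<Longrightarrow> h (f x) = F x"
  shows "forts a b f \<subseteq> forts a b F"
proof -
  have "inj_on F ({x - e<..<x + e} \<inter> {a..b}) \<Longrightarrow> inj_on f ({x - e<..<x + e} \<inter> {a..b})" for x e
    using assms(3) by (metis inj_on_def IntD2)
  then show ?thesis
    unfolding forts_iff_not_inj[OF assms(1)] forts_iff_not_inj[OF assms(2)] subset_iff
    by blast
qed

lemma forts_cong:
  assumes "\<And>x. x \<in> {a..b} \<Longrightarrow> f x = g x"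
  shows "forts a b f = forts a b g"
proof -
  have "strictly_monotone_on (S \<inter> {a..b}) f \<longleftrightarrow> strictly_monotone_on (S \<inter> {a..b}) g" for S
    using assms by (auto simp: strictly_monotone_on_def monotone_on_def)
  then show ?thesis by (simp add: forts_def)
qed

lemma fort_of_valley:
  assumes "strict_antimono_on {l..x} f" "strict_mono_on {x..r} f" "l < x" "x < r" "{l..r} \<subseteq> {a..b}"
  shows "x \<in> forts a b f"
proof -
  have bounds: "a \<le> l" "r \<le> b"
    using assms(3-5) by auto
  have "\<not> strictly_monotone_on ({x - e<..<x + e} \<inter> {a..b}) f" (is "\<not> strictly_monotone_on ?S f")
    if "0 < e" for e
  proof -
    define y where "y = max l (x - e/2)"
    define z where "z = min r (x + e/2)"
    have yz: "y \<in> ?S" "x \<in> ?S" "z \<in> ?S" "l \<le> y" "z \<le> r" "y < x" "x < z"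
      using that bounds assms(3,4) by (auto simp: y_def z_def)
    have "f x < f y"
      using monotone_onD[OF assms(1), of y x] yz by simp
    moreover have "f x < f z"
      using strict_mono_onD[OF assms(2), of x z] yz by simp
    ultimately show ?thesis
      using yz monotone_onD[of ?S "(<)" "(<)" f y x] monotone_onD[of ?S "(<)" "(>)" f x z]
      unfolding strictly_monotone_on_def by fastforce
  qed
  then show ?thesis
    using bounds assms(3,4) by (auto simp: forts_def)
qed

text \<open>As in Rolle's theorem, equal values at two points force an extremum strictly between
  them, which contradicts local strict monotonicity there. So \<open>F\<close> is injective, hence
  strictly monotone.\<close>

lemma strictly_monotone_on_fort_free:
  assumes "continuous_on {l..r} F" "{l..r} \<subseteq> {a..b}" "{l<..<r} \<inter> forts a b F = {}" 
  shows "strictly_monotone_on {l..r} F"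
proof -
  have False if xy: "x \<in> {l..r}" "y \<in> {l..r}" "x < y" "F x = F y" for x y
  proof -
    have cont: "continuous_on {x..y} F"
      by (rule continuous_on_subset[OF assms(1)]) (use xy in auto)
    obtain u where u: "u \<in> {x..y}" "\<And>z. z \<in> {x..y} \<Longrightarrow> F z \<le> F u"
      using continuous_attains_sup[OF _ _ cont] xy(3) by auto
    obtain w where w: "w \<in> {x..y}" "\<And>z. z \<in> {x..y} \<Longrightarrow> F w \<le> F z"
      using continuous_attains_inf[OF _ _ cont] xy(3) by auto
    have "\<exists>z \<in> {x<..<y}. (\<forall>t \<in> {x..y}. F t \<le> F z) \<or> (\<forall>t \<in> {x..y}. F z \<le> F t)"
    proof (cases "u \<in> {x<..<y} \<or> w \<in> {x<..<y}")
      case True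
      then show ?thesis using u(2) w(2) by blast
    next
      \<comment> \<open>Both extrema sit at endpoints with equal values, so \<open>F\<close> is
        constant and any interior point is an extremum.\<close>
      case False
      then have "u = x \<or> u = y" "w = x \<or> w = y"
        using u(1) w(1) by auto
      then have "F u = F x" "F w = F x"
        using xy(4) by auto
      then have const: "F t = F x" if "t \<in> {x..y}" for t
        using u(2)[OF that] w(2)[OF that] by simp
      obtain z where z: "z \<in> {x<..<y}"
        using dense[OF xy(3)] by auto
      have "F t \<le> F z" if "t \<in> {x..y}" for t
        using const[OF that] const[of z] z by simp
      then show ?thesis
        using z by blast
    qed
    then obtain z where z: "z \<in> {x<..<y}"
      and ext: "(\<forall>t \<in> {x..y}. F t \<le> F z) \<or> (\<forall>t \<in> {x..y}. F z \<le> F t)"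
      by blast
    have "z \<notin> forts a b F" "a < z" "z < b"
      using z xy(1,2) assms(2,3) by force+
    then obtain e where e: "e > 0" "strictly_monotone_on ({z - e<..<z + e} \<inter> {a..b}) F"
      by (auto simp: forts_def)
    \<comment> \<open>Neighbours of \<open>z\<close> on either side, within half the radius and
      clipped so as to stay in \<open>{x..y}\<close>.\<close>
    define s where "s = max x (z - e/2)"
    define t where "t = min y (z + e/2)"
    have st: "s < z" "z < t" "s \<in> {x..y}" "t \<in> {x..y}" "s \<in> {z - e<..<z + e} \<inter> {a..b}"
      "t \<in> {z - e<..<z + e} \<inter> {a..b}" "z \<in> {z - e<..<z + e} \<inter> {a..b}"
      using z e(1) xy(1,2) assms(2) \<open>a < z\<close> \<open>z < b\<close> by (auto simp: s_def t_def subset_iff)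
    then have "F s < F z \<and> F z < F t \<or> F s > F z \<and> F z > F t"
      using e(2) unfolding strictly_monotone_on_def monotone_on_def by blast
    then show False
      using ext st by fastforce
  qed
  then have "inj_on F {l..r}"
    by (metis inj_onI linorder_cases)
  then show ?thesis
    unfolding strictly_monotone_on_def
    using injective_eq_monotone_map[OF is_interval_cc assms(1)] by blast
qed

section \<open>Iterates and the height of a square root\<close>

lemma continuous_on_funpow_selfmap:
  assumes "continuous_on S f" "f ` S \<subseteq> S"
  shows "continuous_on S (f ^^ n) \<and> (f ^^ n) ` S \<subseteq> S"
proof (induction n)
  case (Suc n)
  then have "continuous_on S (f \<circ> (f ^^ n))"
    using continuous_on_compose[of S "f ^^ n" f] continuous_on_subset[OF assms(1)] by blast
  then show ?case using Suc assms(2) by auto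
qed (simp add: continuous_on_id')

lemma forts_funpow_Suc:
  assumes "continuous_on {a..b} f" "f ` {a..b} \<subseteq> {a..b}"
  shows "forts a b (f ^^ n) \<subseteq> forts a b (f ^^ Suc n)"
  by (rule forts_subset_of_comp[where h = f])
    (use continuous_on_funpow_selfmap[OF assms] in \<open>blast, blast, simp\<close>)

lemma forts_id: "forts a b (f ^^ 0) = {}"
proof -
  have "\<exists>e>0. strictly_monotone_on ({x - e<..<x + e} \<inter> {a..b}) (f ^^ 0)" for x
    by (intro exI[of _ 1]) (simp add: strictly_monotone_on_def monotone_on_def)
  then show ?thesis by (simp add: forts_def)
qed

lemma num_forts_sq_of_height_1:
  assumes "height a b F = 1"
  shows "num_forts a b (F ^^ 2) = num_forts a b F"
proof -
  have ex: "\<exists>i. num_forts a b (F ^^ i) = num_forts a b (F ^^ Suc i)"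
    using assms by (auto simp: height_def split: if_splits)
  moreover have "(LEAST i. num_forts a b (F ^^ i) = num_forts a b (F ^^ Suc i)) = 1"
    using assms ex by (simp add: height_def one_enat_def)
  ultimately show ?thesis
    using LeastI_ex[OF ex] by (simp add: numeral_2_eq_2)
qed

text \<open>The fort sets of the iterates of \<open>f\<close> increase; the second is that of
  \<open>F\<close> and the fourth that of \<open>F ^^ 2\<close>, of equal cardinality, so the third
  is squeezed between them. Strict growth at the first two steps excludes smaller heights.\<close>

lemma height_sqrt_eq_2:
  assumes f: "continuous_on {a..b} f" "f ` {a..b} \<subseteq> {a..b}"
    and sq: "\<And>x. x \<in> {a..b} \<Longrightarrow> f (f x) = F x"
    and "height a b F = 1" "finite (forts a b F)"
    and "forts a b f \<noteq> {}" "forts a b f \<noteq> forts a b F"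
  shows "height a b f = 2"
proof -
  have f2: "forts a b (f ^^ 2) = forts a b F"
    by (rule forts_cong) (simp add: numeral_2_eq_2 sq)
  have f4: "forts a b (f ^^ 4) = forts a b (F ^^ 2)"
  proof (rule forts_cong)
    fix x assume x: "x \<in> {a..b}"
    then have "F x \<in> {a..b}"
      using f(2) sq[OF x] by (metis image_subset_iff)
    then show "(f ^^ 4) x = (F ^^ 2) x"
      using sq x by (simp add: eval_nat_numeral)
  qed
  have F2: "card (forts a b (F ^^ 2)) = card (forts a b F)"
    using num_forts_sq_of_height_1[OF assms(4)] by (simp add: num_forts_def)
  have sub: "forts a b (f ^^ n) \<subseteq> forts a b (f ^^ Suc n)" for n
    by (rule forts_funpow_Suc[OF f])
  have "forts a b f \<subset> forts a b F"
    using sub[of 1] f2 assms(7) by (simp add: numeral_2_eq_2 psubset_eq)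
  then have lt: "card (forts a b f) < card (forts a b F)" "0 < card (forts a b f)"
    using assms(5,6) psubset_card_mono[OF assms(5)] finite_subset[of "forts a b f"]
    by (auto simp: card_gt_0_iff)
  have num_eqs: "Suc 2 = 3" "Suc 3 = 4"
    by simp_all
  have sub': "forts a b F \<subseteq> forts a b (f ^^ 3)" "forts a b (f ^^ 3) \<subseteq> forts a b (F ^^ 2)"
    using sub[of 2] sub[of 3] f2 f4 num_eqs by (simp_all only:)
  \<comment> \<open>An infinite set would have \<open>card\<close> 0, while this cardinality is
    positive.\<close>
  have "finite (forts a b (F ^^ 2))"
    using F2 lt by (intro card_ge_0_finite) simp
  then have "forts a b F = forts a b (F ^^ 2)"
    using sub' F2 by (intro card_subset_eq) auto
  then have f3: "forts a b (f ^^ 3) = forts a b F"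
    using sub' by blast
  have at2: "num_forts a b (f ^^ 2) = num_forts a b (f ^^ Suc 2)"
    using f2 f3 num_eqs by (simp only: num_forts_def)
  have "2 \<le> i" if "num_forts a b (f ^^ i) = num_forts a b (f ^^ Suc i)" for i
  proof (rule ccontr)
    assume "\<not> 2 \<le> i"
    then consider "i = 0" | "i = 1" by linarith
    then show False
    proof cases
      case 1
      then show False using that lt(2) forts_id[of a b f] by (simp add: num_forts_def)
    next
      case 2
      then show False using that lt(1) f2 by (simp add: num_forts_def numeral_2_eq_2)
    qed
  qed
  then have "(LEAST i. num_forts a b (f ^^ i) = num_forts a b (f ^^ Suc i)) = 2"
    using at2 by (intro Least_equality)
  then show ?thesis
    using exI[of "\<lambda>i. num_forts a b (f ^^ i) = num_forts a b (f ^^ Suc i)", OF at2]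
    unfolding height_def by (simp only: if_True numeral_eq_enat)
qed

section \<open>Extension along the chains of laps\<close>

lemma chain_le:
  fixes d :: "nat \<Rightarrow> real"
  assumes "\<And>j. j \<le> s \<Longrightarrow> d (Suc j) < d j" "i \<le> j" "j \<le> Suc s"
  shows "d j \<le> d i"
  using assms(2,3)
proof (induction j rule: dec_induct)
  case (step j)
  then show ?case using assms(1)[of j] by simp
qed simp

text \<open>Pasting by induction: the chain runs from right to left, and each step adds one interval
  at the left end, where the new piece agrees with the old function.\<close>

lemma glue_chain:
  fixes d :: "nat \<Rightarrow> real" and h :: "nat \<Rightarrow> real \<Rightarrow> 'a::topological_space"
  assumes "\<And>j. j \<le> s \<Longrightarrow> d (Suc j) < d j"
    and "\<And>j. j \<le> s \<Longrightarrow> continuous_on {d (Suc j)..d j} (h j)"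
    and "\<And>j. j < s \<Longrightarrow> h j (d (Suc j)) = h (Suc j) (d (Suc j))"
  shows "\<exists>f. continuous_on {d (Suc s)..d 0} f \<and> (\<forall>j\<le>s. \<forall>x\<in>{d (Suc j)..d j}. f x = h j x)"
  using assms
proof (induction s)
  case 0
  then show ?case by (intro exI[of _ "h 0"]) auto
next
  case (Suc s)
  then obtain f where f: "continuous_on {d (Suc s)..d 0} f"
    "\<And>j x. j \<le> s \<Longrightarrow> x \<in> {d (Suc j)..d j} \<Longrightarrow> f x = h j x"
    by force
  define z where "z = d (Suc s)"
  define f' where "f' x = (if x \<le> z then h (Suc s) x else f x)" for x
  have z_le: "z \<le> d j" if "j \<le> Suc s" for j
    unfolding z_def using Suc.prems(1) by (intro chain_le[of "Suc s" d]) (use that in auto)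
  have agree: "h (Suc s) z = f z"
    using f(2)[of s z] Suc.prems(1)[of s] Suc.prems(3)[of s] by (simp add: z_def)
  have "{x \<in> {d (Suc (Suc s))..d 0}. x \<le> z} = {d (Suc (Suc s))..z}"
    "{x \<in> {d (Suc (Suc s))..d 0}. z \<le> x} = {z..d 0}"
    using z_le[of 0] Suc.prems(1)[of "Suc s"] by (auto simp: z_def)
  then have "continuous_on {d (Suc (Suc s))..d 0} f'"
    unfolding f'_def using f(1) Suc.prems(2)[of "Suc s"] agree
    by (intro continuous_on_cases_1) (simp_all add: z_def)
  moreover have "f' x = h j x" if "j \<le> Suc s" "x \<in> {d (Suc j)..d j}" for j x
  proof (cases "j = Suc s")
    case True
    then show ?thesis using that by (simp add: f'_def z_def)
  next
    case False
    then have "z \<le> x" "f x = h j x"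
      using z_le[of "Suc j"] that f(2)[of j x] by auto
    then show ?thesis
      using agree by (cases "x = z") (simp_all add: f'_def)
  qed
  ultimately show ?case by blast
qed

lemma chain_cover:
  fixes d :: "nat \<Rightarrow> real"
  assumes "x \<in> {d (Suc s)..d 0}"
  shows "\<exists>j\<le>s. x \<in> {d (Suc j)..d j}"
  using assms
proof (induction s)
  case (Suc s)
  show ?case
  proof (cases "d (Suc s) \<le> x")
    case True
    then show ?thesis using Suc by (meson atLeastAtMost_iff le_SucI)
  next
    case False
    then show ?thesis using Suc.prems by (intro exI[of _ "Suc s"]) auto
  qed
qed simp

text \<open>The branches recur in the order \<open>g0\<close>, \<open>g1\<close>, \<open>g2\<close>,
  \<open>g1\<close>. Where \<open>g0\<close> and \<open>g1\<close> meet, \<open>G\<close> equals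
  \<open>\<alpha>\<close>; where \<open>g1\<close> and \<open>g2\<close> meet, it equals
  \<open>\<beta>\<close>; so \<open>match\<close> gives continuity. The abstract form serves the
  left chain directly and the right chain after reflection.\<close>

lemma zigzag_lift:
  fixes d :: "nat \<Rightarrow> real" and G :: "real \<Rightarrow> real" and g0 g1 g2 :: "real \<Rightarrow> real"
  assumes d: "\<And>j. j \<le> s \<Longrightarrow> d (Suc j) < d j"
    and G: "continuous_on {d (Suc s)..d 0} G"
    and g0: "continuous_on S0 g0" and g1: "continuous_on S1 g1" and g2: "continuous_on S2 g2"
    and match: "g0 \<alpha> = g1 \<alpha>" "g2 \<beta> = g1 \<beta>"
    and val: "\<And>j. j \<le> s \<Longrightarrow> G (d j) = (if j mod 4 \<in> {0, 1} then \<alpha> else \<beta>)"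
    and range: "\<And>j x. j \<le> s \<Longrightarrow> x \<in> {d (Suc j)..d j} \<Longrightarrow>
      G x \<in> (if j mod 4 = 0 then S0 else if j mod 4 = 2 then S2 else S1)"
  obtains f where "continuous_on {d (Suc s)..d 0} f"
    "\<And>x. x \<in> {d 1..d 0} \<Longrightarrow> f x = g0 (G x)"
    "\<And>x. x \<in> {d (Suc s)..d 0} \<Longrightarrow>
      G x \<in> S0 \<and> f x = g0 (G x) \<or> G x \<in> S1 \<and> f x = g1 (G x) \<or> G x \<in> S2 \<and> f x = g2 (G x)"
proof -
  define k where "k j = (if j mod 4 = 0 then g0 else if j mod 4 = 2 then g2 else g1)" for j :: nat
  define T where "T j = (if j mod 4 = 0 then S0 else if j mod 4 = 2 then S2 else S1)" for j :: nat
  note d_le = chain_le[of s d, OF d]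
  have "continuous_on {d (Suc j)..d j} (\<lambda>x. k j (G x))" if "j \<le> s" for j
  proof -
    have "continuous_on {d (Suc j)..d j} G"
      using d_le[of "Suc j" "Suc s"] d_le[of 0 j] that
      by (intro continuous_on_subset[OF G]) auto
    moreover have "continuous_on (T j) (k j)"
      using g0 g1 g2 by (simp add: k_def T_def)
    moreover have "G ` {d (Suc j)..d j} \<subseteq> T j"
      using range[OF that] by (auto simp: T_def simp del: atLeastAtMost_iff)
    ultimately show ?thesis
      using continuous_on_compose2 by blast
  qed
  moreover have "k j (G (d (Suc j))) = k (Suc j) (G (d (Suc j)))" if "j < s" for j
  proof -
    \<comment> \<open>One case for each of the four joints of a period.\<close>
    have "j mod 4 = 0 \<or> j mod 4 = 1 \<or> j mod 4 = 2 \<or> j mod 4 = 3"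
      by linarith
    then show ?thesis
      using val[of "Suc j"] that match by (auto simp: k_def mod_Suc)
  qed
  ultimately obtain f where f: "continuous_on {d (Suc s)..d 0} f"
    "\<And>j x. j \<le> s \<Longrightarrow> x \<in> {d (Suc j)..d j} \<Longrightarrow> f x = k j (G x)"
    using glue_chain[of s d "\<lambda>j x. k j (G x)"] d by blast
  show ?thesis
  proof (rule that[of f, OF f(1)])
    show "f x = g0 (G x)" if "x \<in> {d 1..d 0}" for x
      using f(2)[of 0 x] that by (simp add: k_def)
    show "G x \<in> S0 \<and> f x = g0 (G x) \<or> G x \<in> S1 \<and> f x = g1 (G x) \<or> G x \<in> S2 \<and> f x = g2 (G x)"
      if x: "x \<in> {d (Suc s)..d 0}" for x
    proof -
      obtain j where "j \<le> s" "x \<in> {d (Suc j)..d j}"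
        using chain_cover[OF x] by blast
      then show ?thesis
        using f(2)[of j x] range[of j x] by (auto simp: k_def split: if_splits)
    qed
  qed
qed

section \<open>Inverse branches and the extended root\<close>

text \<open>The intermediate value theorem identifies the image, and compactness makes the inverse
  continuous.\<close>

lemma strict_antimono_inverse:
  fixes h :: "real \<Rightarrow> real"
  assumes "u \<le> w" "continuous_on {u..w} h" "strict_antimono_on {u..w} h"
  obtains g where "continuous_on {h w..h u} g" "strict_antimono_on {h w..h u} g"
    "\<And>y. y \<in> {h w..h u} \<Longrightarrow> g y \<in> {u..w} \<and> h (g y) = y"
    "\<And>x. x \<in> {u..w} \<Longrightarrow> g (h x) = x"
proof -
  have inj: "inj_on h {u..w}"
    using assms injective_eq_monotone_map[of "{u..w}" h] is_interval_cc by blast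
  have anti: "h y \<le> h x" if "x \<le> y" "x \<in> {u..w}" "y \<in> {u..w}" for x y
    using that monotone_onD[OF assms(3), of x y] by fastforce
  have image: "h ` {u..w} = {h w..h u}"
    using anti assms(1) IVT2'[of h w _ u, OF _ _ assms(1,2)] by fastforce
  define g where "g = the_inv_into {u..w} h"
  have left: "g (h x) = x" if "x \<in> {u..w}" for x
    unfolding g_def by (rule the_inv_into_f_f[OF inj that])
  have right: "g y \<in> {u..w} \<and> h (g y) = y" if "y \<in> {h w..h u}" for y
    using that left unfolding image[symmetric] by auto
  have "strict_antimono_on {h w..h u} g"
    by (rule monotone_onI) (metis right anti linorder_not_le)
  moreover have "continuous_on {h w..h u} g"
    using continuous_on_inv_into[OF assms(2) compact_Icc inj] by (simp add: g_def image)
  ultimately show ?thesis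
    using that left right by blast
qed


text \<open>The whole construction of the root. The last two conclusions are kept for counting
  forts: \<open>f\<close> decreases on the right of \<open>A\<close>, and also on the left wherever
  \<open>F\<close> increases within the first link.\<close>

lemma increasing_sqrt_extension:
  fixes F :: "real \<Rightarrow> real" and d e :: "nat \<Rightarrow> real" and s t :: nat
  defines "A \<equiv> d 0" and "a \<equiv> d (Suc s)" and "B \<equiv> e 0" and "b \<equiv> e (Suc t)"
  defines "M \<equiv> F A" and "m \<equiv> F B"
  assumes order: "a \<le> A" "A < p" "p < q" "q < B" "B \<le> b"
    and F: "continuous_on {a..b} F" "F ` {a..b} \<subseteq> {p..q}"
    and mono: "strict_antimono_on {A..p} F" "strict_mono_on {p..q} F" "strict_antimono_on {q..B} F"
    and p: "p < m \<and> m < F p \<or> m = p \<and> F p = p"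
    and q: "F q < M \<and> M < q \<or> M = q \<and> F q = q"
    and d: "\<And>j. j \<le> s \<Longrightarrow> d (Suc j) < d j"
    and d_val: "\<And>j. j \<le> s \<Longrightarrow> F (d j) = (if j mod 4 \<in> {0, 1} then M else m)"
    and d_range: "\<And>j x. j \<le> s \<Longrightarrow> x \<in> {d (Suc j)..d j} \<Longrightarrow>
      (j mod 4 \<noteq> 2 \<longrightarrow> F x \<le> M) \<and> (j mod 4 \<noteq> 0 \<longrightarrow> m \<le> F x)"
    and e: "\<And>j. j \<le> t \<Longrightarrow> e j < e (Suc j)"
    and e_val: "\<And>j. j \<le> t \<Longrightarrow> F (e j) = (if j mod 4 \<in> {0, 1} then m else M)"
    and e_range: "\<And>j x. j \<le> t \<Longrightarrow> x \<in> {e j..e (Suc j)} \<Longrightarrow>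
      (j mod 4 \<noteq> 2 \<longrightarrow> m \<le> F x) \<and> (j mod 4 \<noteq> 0 \<longrightarrow> F x \<le> M)"
  obtains f where "continuous_on {a..b} f" "f ` {a..b} \<subseteq> {a..b}" "\<And>x. x \<in> {a..b} \<Longrightarrow> f (f x) = F x"
    "strict_mono_on {p..q} f" "strict_antimono_on {A..p} f"
    "\<And>S. S \<subseteq> {d 1..A} \<Longrightarrow> strict_mono_on S F \<Longrightarrow> strict_antimono_on S f"
proof -
  obtain \<phi> where \<phi>: "strict_mono \<phi>" "surj \<phi>" "\<And>x. x \<in> {p..q} \<Longrightarrow> \<phi> (\<phi> x) = F x"
    "\<phi> p = m" "\<phi> q = M"
    using interval_increasing_sqrt[of p q F m M] order F(1) mono(2) p q
      continuous_on_subset[OF F(1), of "{p..q}"] by auto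
  define \<theta> where "\<theta> = inv \<phi>"
  have \<theta>\<phi>: "\<theta> (\<phi> x) = x" "\<phi> (\<theta> x) = x" for x
    using \<phi>(1,2) by (simp_all add: \<theta>_def strict_mono_imp_inj_on surj_f_inv_f)
  have \<theta>: "strict_mono \<theta>"
    by (rule strict_mono_inv[OF \<phi>(1,2) \<theta>\<phi>(1)])
  have "surj \<theta>"
    using \<theta>\<phi>(1) by (metis surj_def)
  then have \<theta>_cont: "continuous_on S \<theta>" for S
    by (rule strict_mono_surj_continuous[OF \<theta>])
  have \<theta>_vals: "\<theta> M = q" "\<theta> m = p"
    using \<theta>\<phi>(1)[of q] \<theta>\<phi>(1)[of p] \<phi>(4,5) by auto
  \<comment> \<open>On \<open>{p..q}\<close> this is \<open>\<phi>\<close> again, because there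
    \<open>F\<close> is \<open>\<phi>\<close> applied twice.\<close>
  define h where "h x = \<theta> (F x)" for x
  have h_in: "h x = \<phi> x" if "x \<in> {p..q}" for x
    using \<phi>(3)[OF that] \<theta>\<phi>(1)[of "\<phi> x"] by (simp add: h_def)
  have h_cont: "continuous_on S h" if "S \<subseteq> {a..b}" for S
    unfolding h_def
    by (rule continuous_on_compose2[OF \<theta>_cont[of UNIV] continuous_on_subset[OF F(1) that]]) simp
  have h_anti: "strict_antimono_on S h" if "strict_antimono_on S F" for S
    using that strict_monoD[OF \<theta>] by (simp add: h_def monotone_on_def)
  have h_vals: "h A = q" "h B = p" "h p = m" "h q = M"
    using \<theta>_vals h_in[of p] h_in[of q] order \<phi>(4,5) by (simp_all add: h_def flip: M_def m_def)
  have "{q..B} \<subseteq> {a..b}" "{A..p} \<subseteq> {a..b}" "q \<le> B" "A \<le> p"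
    using order by auto
  obtain gR where "continuous_on {h B..h q} gR" "strict_antimono_on {h B..h q} gR"
    "\<And>y. y \<in> {h B..h q} \<Longrightarrow> gR y \<in> {q..B} \<and> h (gR y) = y" "\<And>x. x \<in> {q..B} \<Longrightarrow> gR (h x) = x"
    using strict_antimono_inverse[OF \<open>q \<le> B\<close> h_cont[OF \<open>{q..B} \<subseteq> {a..b}\<close>] h_anti[OF mono(3)]]
    by blast
  note gR = this[unfolded h_vals]
  obtain gL where "continuous_on {h p..h A} gL" "strict_antimono_on {h p..h A} gL"
    "\<And>y. y \<in> {h p..h A} \<Longrightarrow> gL y \<in> {A..p} \<and> h (gL y) = y" "\<And>x. x \<in> {A..p} \<Longrightarrow> gL (h x) = x"
    using strict_antimono_inverse[OF \<open>A \<le> p\<close> h_cont[OF \<open>{A..p} \<subseteq> {a..b}\<close>] h_anti[OF mono(1)]]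
    by blast
  note gL = this[unfolded h_vals]
  \<comment> \<open>Both branches take the value \<open>q\<close> at \<open>M\<close>, and both take
    \<open>p\<close> at \<open>m\<close>; these are the joints of the chains.\<close>
  have match: "gR M = \<theta> M" "gL m = \<theta> m"
    using gR(4)[of q] gL(4)[of p] h_vals \<theta>_vals order by auto
  have pMq: "p \<le> m" "M \<le> q" "m \<le> F p" "F q \<le> M"
    using p q by auto
  have Fpq: "p \<le> F x" "F x \<le> q" if "x \<in> {a..b}" for x
    using F(2) that unfolding image_subset_iff by auto
  have mid: "h x \<in> {p..q}" if "m \<le> F x" "F x \<le> M" for x
    using that strict_mono_less_eq[OF \<theta>] \<theta>_vals unfolding h_def by (metis atLeastAtMost_iff)

  \<comment> \<open>Whichever branch is used, its value lies where \<open>f\<close> will be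
    \<open>h\<close>, and \<open>h\<close> undoes the branch. This reduces
    \<open>f (f x) = F x\<close> outside the middle to a property of single values.\<close>
  have good: "y \<in> {A..B} \<and> h y = F x"
    if "F x \<in> {p..M} \<and> y = gR (F x) \<or> F x \<in> {m..M} \<and> y = \<theta> (F x) \<or> F x \<in> {m..q} \<and> y = gL (F x)"
    for x y
    using that
  proof (elim disjE conjE)
    assume "F x \<in> {p..M}" "y = gR (F x)"
    then show ?thesis using gR(3) order by fastforce
  next
    assume "F x \<in> {m..q}" "y = gL (F x)"
    then show ?thesis using gL(3) order by fastforce
  next
    assume "F x \<in> {m..M}" "y = \<theta> (F x)"
    then have "y \<in> {p..q}" using mid by (simp add: h_def)
    then show ?thesis
      using h_in[of y] \<open>y = \<theta> (F x)\<close> \<theta>\<phi>(2) order by auto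
  qed

  have d_in: "{d (Suc s)..d 0} \<subseteq> {a..b}" "{e 0..e (Suc t)} \<subseteq> {a..b}"
    using order by (auto simp: A_def a_def B_def b_def)
  have sub_d: "{d (Suc j)..d j} \<subseteq> {a..b}" if "j \<le> s" for j
    using chain_le[of s d 0 j, OF d] chain_le[of s d "Suc j" "Suc s", OF d] d_in(1) that by force
  have sub_e: "{e j..e (Suc j)} \<subseteq> {a..b}" if "j \<le> t" for j
    using chain_le[of t "\<lambda>j. - e j" 0 j] chain_le[of t "\<lambda>j. - e j" "Suc j" "Suc t"] e d_in(2) that
    by force
  obtain fL where fL: "continuous_on {d (Suc s)..d 0} fL"
    "\<And>x. x \<in> {d 1..d 0} \<Longrightarrow> fL x = gR (F x)"
    "\<And>x. x \<in> {d (Suc s)..d 0} \<Longrightarrow> F x \<in> {p..M} \<and> fL x = gR (F x) \<or>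
      F x \<in> {m..M} \<and> fL x = \<theta> (F x) \<or> F x \<in> {m..q} \<and> fL x = gL (F x)"
  proof (rule zigzag_lift[OF d continuous_on_subset[OF F(1) d_in(1)] gR(1) \<theta>_cont gL(1) match d_val])
    fix j x assume jx: "j \<le> s" "x \<in> {d (Suc j)..d j}"
    then show "F x \<in> (if j mod 4 = 0 then {p..M} else if j mod 4 = 2 then {m..q} else {m..M})"
      using d_range[OF jx] Fpq[of x] sub_d[of j] by auto
  qed auto
  \<comment> \<open>The right chain, reflected by negation to run downwards. The roles of
    \<open>gL\<close> and \<open>gR\<close>, and of \<open>m\<close> and \<open>M\<close>, are
    exchanged.\<close>
  obtain fR where fR: "continuous_on {- e (Suc t)..- e 0} fR"
    "\<And>x. x \<in> {- e (Suc t)..- e 0} \<Longrightarrow> F (- x) \<in> {m..q} \<and> fR x = gL (F (- x)) \<or>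
      F (- x) \<in> {m..M} \<and> fR x = \<theta> (F (- x)) \<or> F (- x) \<in> {p..M} \<and> fR x = gR (F (- x))"
    "\<And>x. x \<in> {- e 1..- e 0} \<Longrightarrow> fR x = gL (F (- x))"
  proof (rule zigzag_lift[of t "\<lambda>j. - e j" "\<lambda>x. F (- x)" "{m..q}" gL "{m..M}" \<theta> "{p..M}" gR m M])
    show "continuous_on {- e (Suc t)..- e 0} (\<lambda>x. F (- x))"
      by (rule continuous_on_compose2[OF F(1)]) (use d_in(2) in \<open>auto intro!: continuous_intros\<close>)
    fix j x assume jx: "j \<le> t" "x \<in> {- e (Suc j)..- e j}"
    then have "- x \<in> {e j..e (Suc j)}" by auto
    then show "F (- x) \<in> (if j mod 4 = 0 then {m..q} else if j mod 4 = 2 then {p..M} else {m..M})"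
      using e_range[OF jx(1)] Fpq[of "- x"] sub_e[OF jx(1)] by auto
  qed (use e e_val match gL(1) gR(1) \<theta>_cont in auto)
  have fL_good: "fL x \<in> {A..B} \<and> h (fL x) = F x" if "x \<in> {a..A}" for x
    using fL(3)[of x] good[of x "fL x"] that unfolding a_def A_def by blast
  have fR_good: "fR (- x) \<in> {A..B} \<and> h (fR (- x)) = F x" if "x \<in> {B..b}" for x
    using fR(2)[of "- x"] good[of x "fR (- x)"] that unfolding b_def B_def by auto
  \<comment> \<open>Monotonicity on the three laps confines \<open>F\<close> to
    \<open>{m..M}\<close> on \<open>{A..B}\<close>, so \<open>h\<close> lands in
    \<open>{p..q}\<close>, where it acts as \<open>\<phi>\<close> and cancels
    \<open>\<theta>\<close>.\<close>
  have h_mid: "h x \<in> {p..q} \<and> h (h x) = F x" if x: "x \<in> {A..B}" for x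
  proof -
    consider "x \<in> {A..p}" | "x \<in> {p..q}" | "x \<in> {q..B}"
      using x by fastforce
    then have "m \<le> F x \<and> F x \<le> M"
    proof cases
      case 1
      then have "F p \<le> F x" "F x \<le> F A"
        using monotone_onD[OF mono(1), of x p] monotone_onD[OF mono(1), of A x] order by fastforce+
      then show ?thesis using pMq by (simp flip: M_def)
    next
      case 2
      then have "F p \<le> F x" "F x \<le> F q"
        using strict_mono_onD[OF mono(2), of x q] strict_mono_onD[OF mono(2), of p x] order by fastforce+
      then show ?thesis using pMq by simp
    next
      case 3
      then have "F B \<le> F x" "F x \<le> F q"
        using monotone_onD[OF mono(3), of x B] monotone_onD[OF mono(3), of q x] order by fastforce+
      then show ?thesis using pMq by (simp flip: m_def)
    qed
    then have "h x \<in> {p..q}" by (intro mid) auto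
    then show ?thesis
      using h_in[of "h x"] \<theta>\<phi>(2) by (simp add: h_def)
  qed
  define f where "f x = (if x \<le> A then fL x else if x \<le> B then h x else fR (- x))" for x
  \<comment> \<open>The common value is \<open>q\<close> at \<open>A\<close> and \<open>p\<close> at
    \<open>B\<close>.\<close>
  have f_A: "fL A = h A" and f_B: "h B = fR (- B)"
    using fL(2)[of A] fR(3)[of "- B"] d[of 0] e[of 0] match \<theta>_vals h_vals
    by (simp_all add: A_def B_def M_def m_def)
  have f_mid: "f x = h x" if "x \<in> {A..B}" for x
    using that f_A by (auto simp: f_def)
  have f_good: "f x \<in> {A..B} \<and> h (f x) = F x" if "x \<in> {a..b}" for x
    using that fL_good[of x] fR_good[of x] h_mid[of x] order unfolding f_def by force
  have "continuous_on {a..b} f"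
    unfolding f_def
  proof (intro continuous_on_cases_1)
    have "{x \<in> {a..b}. x \<le> A} = {d (Suc s)..d 0}"
      using order by (auto simp: a_def A_def)
    then show "continuous_on {x \<in> {a..b}. x \<le> A} fL" using fL(1) by simp
    show "continuous_on {x \<in> {x \<in> {a..b}. A \<le> x}. x \<le> B} h"
      by (rule h_cont) auto
    show "continuous_on {x \<in> {x \<in> {a..b}. A \<le> x}. B \<le> x} (\<lambda>x. fR (- x))"
      by (rule continuous_on_compose2[OF fR(1)])
        (use order in \<open>auto intro!: continuous_intros simp: b_def B_def\<close>)
  qed (use f_A f_B order in auto)
  moreover have "f ` {a..b} \<subseteq> {a..b}"
    using f_good order by force
  moreover have "f (f x) = F x" if "x \<in> {a..b}" for x
    using f_good[OF that] f_mid by simp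
  moreover have "strict_mono_on {p..q} f"
    using strict_monoD[OF \<phi>(1)] f_mid h_in order by (intro strict_mono_onI) auto
  moreover have "strict_antimono_on {A..p} f"
  proof -
    have "f x = h x" if "x \<in> {A..p}" for x
      using that f_mid order by auto
    then show ?thesis
      using h_anti[OF mono(1)] by (simp add: monotone_on_def)
  qed
  \<comment> \<open>On the first link \<open>f\<close> is \<open>gR \<circ> F\<close>, and the
    decreasing \<open>gR\<close> reverses the direction of \<open>F\<close>.\<close>
  moreover have "strict_antimono_on S f" if S: "S \<subseteq> {d 1..A}" "strict_mono_on S F" for S
  proof -
    have f_S: "f x = gR (F x)" "F x \<in> {p..M}" if "x \<in> S" for x
    proof -
      have "x \<in> {d 1..d 0}" "x \<le> A"
        using S(1) that by (auto simp: A_def)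
      then show "f x = gR (F x)" "F x \<in> {p..M}"
        using fL(2)[of x] d_range[of 0 x] Fpq[of x] sub_d[of 0] by (auto simp: f_def)
    qed
    show ?thesis
    proof (rule monotone_onI)
      fix x y assume "x \<in> S" "y \<in> S" "x < y"
      then show "f x > f y"
        using monotone_onD[OF gR(2), of "F x" "F y"] strict_mono_onD[OF S(2)] f_S by simp
    qed
  qed
  ultimately show ?thesis
    by (rule that)
qed

section \<open>The iterative root of height 2\<close>

theorem theorem2p2:
  fixes a b :: real and F :: "real \<Rightarrow> real" and c :: "nat \<Rightarrow> real" and v k :: nat
  assumes "a < b"
    and "F \<in> PM a b"
    and "strict_mono_on {1..v} c" and "c ` {1..v} = forts a b F"
    and "c 0 = a" and "c (v + 1) = b"
    and "height a b F = 1"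
    and "1 \<le> k" and "k + 1 \<le> v"
    and "is_char_interval a b F {c k..c (k + 1)}"
    and "strict_mono_on {c k..c (k + 1)} F"
    and "\<not> char_endpoints_condition a b F (c k) (c (k + 1))"
    and "(c k < F (c (k + 2)) \<and> F (c (k + 2)) < F (c k) \<and>
          F (c (k - 1)) = c (k + 1) \<and> c (k + 1) = F (c (k + 1)))
       \<or> (c k = F (c k) \<and> F (c k) = F (c (k + 2)) \<and>
          F (c (k + 1)) < F (c (k - 1)) \<and> F (c (k - 1)) < c (k + 1))
       \<or> (c k < F (c (k + 2)) \<and> F (c (k + 2)) < F (c k) \<and>
          F (c (k + 1)) < F (c (k - 1)) \<and> F (c (k - 1)) < c (k + 1))"
    and L: "\<exists>(s::nat) (l :: nat \<Rightarrow> nat).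
      l 0 = k - 1 \<and> l (s + 1) = 0 \<and> (\<forall>j\<le>s + 1. l j \<in> {0..v}) \<and>
      (\<forall>j\<le>s. c (l (j + 1)) < c (l j)) \<and>
      (\<forall>j\<le>s. (j mod 4 \<in> {0, 1} \<longrightarrow> F (c (l j)) = F (c (k - 1))) \<and>
              (j mod 4 \<in> {2, 3} \<longrightarrow> F (c (l j)) = F (c (k + 2)))) \<and>
      (\<forall>j\<le>s. j mod 4 \<in> {0, 1, 3} \<longrightarrow> is_max_on F {c (l (j + 1))..c (l j)} (F (c (k - 1)))) \<and>
      (\<forall>j\<le>s. j mod 4 \<in> {1, 2, 3} \<longrightarrow> is_min_on F {c (l (j + 1))..c (l j)} (F (c (k + 2))))"
    and R: "\<exists>(t::nat) (r :: nat \<Rightarrow> nat).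
      r 0 = k + 2 \<and> r (t + 1) = v + 1 \<and> (\<forall>j\<le>t + 1. r j \<in> {1..v + 1}) \<and>
      (\<forall>j\<le>t. c (r j) < c (r (j + 1))) \<and>
      (\<forall>j\<le>t. (j mod 4 \<in> {0, 1} \<longrightarrow> F (c (r j)) = F (c (k + 2))) \<and>
              (j mod 4 \<in> {2, 3} \<longrightarrow> F (c (r j)) = F (c (k - 1)))) \<and>
      (\<forall>j\<le>t. j mod 4 \<in> {0, 1, 3} \<longrightarrow> is_min_on F {c (r j)..c (r (j + 1))} (F (c (k + 2)))) \<and>
      (\<forall>j\<le>t. j mod 4 \<in> {1, 2, 3} \<longrightarrow> is_max_on F {c (r j)..c (r (j + 1))} (F (c (k - 1))))"
  shows "\<exists>f. f \<in> PM a b \<and> (\<forall>x\<in>{a..b}. f (f x) = F x) \<and> height a b f = 2 \<and>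
             strict_mono_on {c k..c (k + 1)} f"
proof -
  define A p q B where "A = c (k - 1)" and "p = c k" and "q = c (k + 1)" and "B = c (k + 2)"
  note pts = A_def p_def q_def B_def
  have F: "continuous_on {a..b} F" "finite (forts a b F)" "F ` {a..b} \<subseteq> {p..q}"
    using assms(2,10) by (auto simp: PM_def is_char_interval_def pts)
  have k: "1 \<le> k" "k + 1 \<le> v"
    by (rule assms(8,9))+
  have fort: "c i \<in> forts a b F" if "1 \<le> i" "i \<le> v" for i
    unfolding assms(4)[symmetric] using that by auto
  \<comment> \<open>Forts lie strictly inside the interval, so the order of the \<open>c i\<close>
    extends to the endpoint indices 0 and \<open>v + 1\<close>.\<close>
  have c_less: "c i < c j" if "i < j" "j \<le> v + 1" for i j
  proof -
    have "c i < b" if "1 \<le> i" "i \<le> v" for i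
      using fort[OF that] by (auto simp: forts_def)
    moreover have "a < c i" if "1 \<le> i" "i \<le> v" for i
      using fort[OF that] by (auto simp: forts_def)
    moreover have "c i < c j" if "1 \<le> i" "i < j" "j \<le> v" for i j
      using strict_mono_onD[OF assms(3)] that by simp
    ultimately show ?thesis
      using that assms(1,5,6) by (cases "i = 0"; cases "j = v + 1") auto
  qed
  have c_le: "c i \<le> c j" if "i \<le> j" "j \<le> v + 1" for i j
    using c_less[of i j] that by (cases "i = j") auto
  have lap: "strictly_monotone_on {c i..c (Suc i)} F" if "i \<le> v" for i
  proof (rule strictly_monotone_on_fort_free)
    show sub: "{c i..c (Suc i)} \<subseteq> {a..b}"
      using c_le[of 0 i] c_le[of "Suc i" "v + 1"] that assms(5,6) by auto
    then show "continuous_on {c i..c (Suc i)} F"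
      by (rule continuous_on_subset[OF F(1)])
    have "\<not> (c i < c j \<and> c j < c (Suc i))" if "1 \<le> j" "j \<le> v" for j
      using c_le[of j i] c_le[of "Suc i" j] that \<open>i \<le> v\<close> by (cases "j \<le> i") auto
    then show "{c i<..<c (Suc i)} \<inter> forts a b F = {}"
      unfolding assms(4)[symmetric] by auto
  qed

  obtain s :: nat and l :: "nat \<Rightarrow> nat" where l: "l 0 = k - 1" "l (s + 1) = 0" "\<And>j. j \<le> s + 1 \<Longrightarrow> l j \<in> {0..v}"
    "\<And>j. j \<le> s \<Longrightarrow> c (l (j + 1)) < c (l j)"
    "\<And>j. j \<le> s \<Longrightarrow> (j mod 4 \<in> {0, 1} \<longrightarrow> F (c (l j)) = F A) \<and> (j mod 4 \<in> {2, 3} \<longrightarrow> F (c (l j)) = F B)"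
    "\<And>j. j \<le> s \<Longrightarrow> j mod 4 \<in> {0, 1, 3} \<Longrightarrow> is_max_on F {c (l (j + 1))..c (l j)} (F A)"
    "\<And>j. j \<le> s \<Longrightarrow> j mod 4 \<in> {1, 2, 3} \<Longrightarrow> is_min_on F {c (l (j + 1))..c (l j)} (F B)"
    using L unfolding pts by blast
  obtain t :: nat and r :: "nat \<Rightarrow> nat" where r: "r 0 = k + 2" "r (t + 1) = v + 1" "\<And>j. j \<le> t + 1 \<Longrightarrow> r j \<in> {1..v + 1}"
    "\<And>j. j \<le> t \<Longrightarrow> c (r j) < c (r (j + 1))"
    "\<And>j. j \<le> t \<Longrightarrow> (j mod 4 \<in> {0, 1} \<longrightarrow> F (c (r j)) = F B) \<and> (j mod 4 \<in> {2, 3} \<longrightarrow> F (c (r j)) = F A)"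
    "\<And>j. j \<le> t \<Longrightarrow> j mod 4 \<in> {0, 1, 3} \<Longrightarrow> is_min_on F {c (r j)..c (r (j + 1))} (F B)"
    "\<And>j. j \<le> t \<Longrightarrow> j mod 4 \<in> {1, 2, 3} \<Longrightarrow> is_max_on F {c (r j)..c (r (j + 1))} (F A)"
    using R unfolding pts by blast
  \<comment> \<open>For \<open>k = 1\<close> the left chain would start at \<open>a\<close>, leaving
    no room for its first link. Hence \<open>A\<close> is an interior point and a fort, with a lap
    on its left.\<close>
  have "k \<noteq> 1"
    using l(4)[of 0] l(1) l(3)[of 1] c_le[of 0 "l 1"] by auto
  then have k2: "2 \<le> k"
    using k by simp
  define Z where "Z = c (k - 2)"
  have idx: "Suc (k - 2) = k - 1" "Suc (k - 1) = k" "Suc (k + 1) = k + 2"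
    using k2 by simp_all
  have order: "a \<le> Z" "Z < A" "A < p" "p < q" "q < B" "B \<le> b"
    using c_le[of 0 "k - 2"] c_less[of "k - 2" "k - 1"] c_less[of "k - 1" k] c_less[of k "k + 1"]
      c_less[of "k + 1" "k + 2"] c_le[of "k + 2" "v + 1"] k k2 assms(5,6)
    by (auto simp: pts Z_def)
  have forts: "A \<in> forts a b F" "p \<in> forts a b F" "q \<in> forts a b F"
    using fort[of "k - 1"] fort[of k] fort[of "k + 1"] k k2 by (auto simp: pts)
  have laps: "strictly_monotone_on {Z..A} F" "strictly_monotone_on {A..p} F"
    "strictly_monotone_on {q..B} F"
    using lap[of "k - 2"] lap[of "k - 1"] lap[of "k + 1"] k idx by (simp_all add: pts Z_def)
  have inc: "strict_mono_on {p..q} F"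
    using assms(11) by (simp add: pts)
  \<comment> \<open>Strict monotonicity cannot continue across a fort, so the direction alternates
    from lap to lap, starting from the increasing lap \<open>{p..q}\<close>.\<close>
  have turn: "\<not> strict_mono_on {u..w} F" "\<not> strict_antimono_on {u..w} F"
    if "x \<in> forts a b F" "u < x" "x < w" for u x w
    using not_fort_of_strictly_monotone[of u w F x a b] that
    unfolding strictly_monotone_on_def by blast+
  have dec_Ap: "strict_antimono_on {A..p} F"
    using laps(2) turn(1)[OF forts(2), of A q] order strict_mono_on_Icc_join[OF _ inc]
    unfolding strictly_monotone_on_def by blast
  have dec_qB: "strict_antimono_on {q..B} F"
    using laps(3) turn(1)[OF forts(3), of p B] order strict_mono_on_Icc_join[OF inc]
    unfolding strictly_monotone_on_def by blast
  have inc_ZA: "strict_mono_on {Z..A} F"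
    using laps(1) turn(2)[OF forts(1), of Z p] order strict_antimono_on_Icc_join[OF _ dec_Ap]
    unfolding strictly_monotone_on_def by blast

  have ends: "c (l 0) = A" "c (l (Suc s)) = a" "c (r 0) = B" "c (r (Suc t)) = b"
    using l(1,2) r(1,2) assms(5,6) by (simp_all add: pts)
  have mod4: "j mod 4 = 0 \<or> j mod 4 = 1 \<or> j mod 4 = 2 \<or> j mod 4 = 3" for j :: nat
    by linarith
  obtain f where f: "continuous_on {a..b} f" "f ` {a..b} \<subseteq> {a..b}" "\<And>x. x \<in> {a..b} \<Longrightarrow> f (f x) = F x"
    "strict_mono_on {p..q} f" "strict_antimono_on {A..p} f"
    "\<And>S. S \<subseteq> {c (l 1)..A} \<Longrightarrow> strict_mono_on S F \<Longrightarrow> strict_antimono_on S f"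
  proof (rule increasing_sqrt_extension[where F = F and d = "\<lambda>j. c (l j)" and e = "\<lambda>j. c (r j)"
        and s = s and t = t and p = p and q = q, unfolded ends])
    \<comment> \<open>Each of the three alternatives in the hypothesis selects one option at
      \<open>p\<close> and one at \<open>q\<close>; only the combination with both ends fixed is
      absent.\<close>
    show "p < F B \<and> F B < F p \<or> F B = p \<and> F p = p" "F q < F A \<and> F A < q \<or> F A = q \<and> F q = q"
      using assms(13) by (auto simp: pts)
    show "F (c (l j)) = (if j mod 4 \<in> {0, 1} then F A else F B)" if "j \<le> s" for j
      using l(5)[OF that] mod4[of j] by auto
    show "F (c (r j)) = (if j mod 4 \<in> {0, 1} then F B else F A)" if "j \<le> t" for j
      using r(5)[OF that] mod4[of j] by auto
    show "(j mod 4 \<noteq> 2 \<longrightarrow> F x \<le> F A) \<and> (j mod 4 \<noteq> 0 \<longrightarrow> F B \<le> F x)"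
      if "j \<le> s" "x \<in> {c (l (Suc j))..c (l j)}" for j x
      using l(6,7)[OF that(1)] that(2) mod4[of j] by (auto simp: is_max_on_def is_min_on_def)
    show "(j mod 4 \<noteq> 2 \<longrightarrow> F B \<le> F x) \<and> (j mod 4 \<noteq> 0 \<longrightarrow> F x \<le> F A)"
      if "j \<le> t" "x \<in> {c (r j)..c (r (Suc j))}" for j x
      using r(6,7)[OF that(1)] that(2) mod4[of j] by (auto simp: is_max_on_def is_min_on_def)
  qed (use order F dec_Ap inc dec_qB l(4) r(4) in \<open>simp_all\<close>)

  have sub: "forts a b f \<subseteq> forts a b F"
    by (rule forts_subset_of_comp[OF f(1) F(1) f(3)])
  \<comment> \<open>\<open>f\<close> turns from decreasing to increasing at \<open>p\<close>, so its
    fort set is not empty.\<close>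
  have "p \<in> forts a b f"
    using fort_of_valley[OF f(5,4)] order by auto
  \<comment> \<open>To the right of \<open>z\<close>, up to \<open>A\<close>, the map
    \<open>F\<close> increases and the first link of the chain applies at once, so \<open>f\<close>
    decreases there.\<close>
  define z where "z = max Z (c (l 1))"
  have z: "z < A"
    using order l(4)[of 0] ends by (simp add: z_def)
  have "strict_antimono_on {z..A} f"
    by (rule f(6)) (auto simp: z_def intro: monotone_on_subset[OF inc_ZA])
  \<comment> \<open>\<open>f\<close> decreases through \<open>A\<close>, a fort of \<open>F\<close>;
    so the inclusion of fort sets is strict.\<close>
  then have "A \<notin> forts a b f"
    using strict_antimono_on_Icc_join[OF _ f(5)] z order(3)
    by (intro not_fort_of_strictly_monotone[of z p]) (auto simp: strictly_monotone_on_def)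
  then have "height a b f = 2"
    using \<open>p \<in> forts a b f\<close> forts(1) F(2) assms(7) by (intro height_sqrt_eq_2[OF f(1-3)]) auto
  moreover have "f \<in> PM a b"
    using f(1,2) sub F(2) finite_subset by (auto simp: PM_def)
  ultimately show ?thesis
    using f(3,4) by (auto simp: pts)
qed

end
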